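(* Let $K$ be an algebraically closed field of characteristic zero, complete with respect to a non-Archimedean norm, and let $f:\mathbf{A}^1\to\mathbf{A}^1$ be a polynomial map of degree $d>1$ over $K$. Then there exists a Radon probability measure $\rho=\rho_f$ on the Berkovich affine line $\mathbf{A}^1_{\mathrm{Berk}}$ over $K$ such that for all points $x\in\mathbf{A}^1$, with at most one exception, we have $$\lim_{n\to\infty}d^{-n}f^{n*}\delta_x=\rho$$ in the weak sense of measures on $\mathbf{A}^1_{\mathrm{Berk}}$. Furthermore, a point $x\in\mathbf{A}^1$ is exceptional (i.e. this convergence fails for $x$) if and only if there exists a global coordinate $z$ on $\mathbf{A}^1$ vanishing at $x$ such that $f$ is given by the polynomial $z\mapsto z^d$. In this case, $d^{-n}f^{n*}\delta_x=\delta_x$ for all $n$.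
   Context: $\mathbf{A}^1\cong K$ denotes the set of closed points of the affine line over $K$ (maximal ideals of $R\cong K[z]$); a global coordinate is an element $z\in R$ with $R=K[z]$. $\mathbf{A}^1_{\mathrm{Berk}}$ is the set of multiplicative seminorms on $R$ whose restriction to $K$ is the given norm, with the topology of pointwise convergence on $R$ (it is a locally compact Hausdorff space). A point $x\in\mathbf{A}^1$ is identified with the seminorm $\phi\mapsto|\phi(x)|$, so $\mathbf{A}^1\subseteq\mathbf{A}^1_{\mathrm{Berk}}$. For $x\in\mathbf{A}^1$ and $n\ge1$, $f^n$ is the $n$-th iterate and $f^{n*}\delta_x=\sum_{f^n(y)=x}\delta_y$, the sum being over the $d^n$ preimages $y\in\mathbf{A}^1$ of $x$ under $f^n$ counted with multiplicity (multiplicity of $y$ as a root of $f^n-x$). Weak convergence of Radon probability measures means convergence of integrals of compactly supported continuous functions. *)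

theory Defs
  imports
    "HOL-Probability.Probability"
    "HOL-Computational_Algebra.Computational_Algebra"
begin

text \<open>The trivial norm (constantly \<open>1\<close> away from \<open>0\<close>) is not excluded.\<close>

definition nonarch_norm :: "('a::field \<Rightarrow> real) \<Rightarrow> bool" where
  "nonarch_norm N \<longleftrightarrow>
     (\<forall>x. 0 \<le> N x) \<and>
     (\<forall>x. N x = 0 \<longleftrightarrow> x = 0) \<and>
     (\<forall>x y. N (x * y) = N x * N y) \<and>
     (\<forall>x y. N (x + y) \<le> max (N x) (N y))"

lemma nonarch_norm_one:
  assumes "nonarch_norm N"
  shows "N 1 = 1"
proof -
  have "N (1 * 1) = N 1 * N 1" "N 1 \<noteq> 0"
    using assms unfolding nonarch_norm_def by (blast, simp)
  then show ?thesis by simp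
qed

lemma nonarch_norm_minus:
  assumes "nonarch_norm N"
  shows "N (- x) = N x"
proof -
  have mult: "\<And>x y. N (x * y) = N x * N y" and nonneg: "0 \<le> N (-1)"
    using assms by (auto simp: nonarch_norm_def)
  have "N (-1) * N (-1) = 1"
    using mult[of "-1" "-1"] nonarch_norm_one[OF assms] by simp
  with nonneg have "N (-1) = 1"
    by (metis abs_of_nonneg real_sqrt_abs2 real_sqrt_one)
  then show ?thesis using mult[of "-1" x] by simp
qed

text \<open>The library notion of completeness below is only meaningful for a metric.\<close>

lemma nonarch_norm_metric:
  assumes "nonarch_norm N"
  shows "Metric_space UNIV (\<lambda>x y. N (x - y))"
proof
  fix x y z
  have *: "0 \<le> N u" "N u = 0 \<longleftrightarrow> u = 0" "N (u + v) \<le> max (N u) (N v)" for u v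
    using assms by (auto simp: nonarch_norm_def)
  show "0 \<le> N (x - y)" by (rule *)
  show "N (x - y) = N (y - x)"
    using nonarch_norm_minus[OF assms, of "x - y"] by simp
  show "N (x - y) = 0 \<longleftrightarrow> x = y" by (simp add: *)
  show "N (x - z) \<le> N (x - y) + N (y - z)"
    using *(3)[of "x - y" "y - z"] *(1)[of "x - y"] *(1)[of "y - z"] by simp
qed

definition complete_nonarch_norm :: "('a::field \<Rightarrow> real) \<Rightarrow> bool" where
  "complete_nonarch_norm N \<longleftrightarrow>
     nonarch_norm N \<and> Metric_space.mcomplete UNIV (\<lambda>x y. N (x - y))"

text \<open>
  The coordinate ring \<open>R\<close> is the type \<open>'a poly\<close>, the closed points are the elements of \<open>'a\<close>.
  \<open>S 0 = 0\<close> and \<open>S 1 = 1\<close> follow from the last clause.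
\<close>

definition berkovich_seminorm :: "('a::field \<Rightarrow> real) \<Rightarrow> ('a poly \<Rightarrow> real) \<Rightarrow> bool" where
  "berkovich_seminorm N S \<longleftrightarrow>
     (\<forall>p. 0 \<le> S p) \<and>
     (\<forall>p q. S (p * q) = S p * S q) \<and>
     (\<forall>p q. S (p + q) \<le> S p + S q) \<and>
     (\<forall>c. S [:c:] = N c)"

definition berkovich_line :: "('a::field \<Rightarrow> real) \<Rightarrow> ('a poly \<Rightarrow> real) topology" where
  "berkovich_line N = subtopology (powertop_real UNIV) {S. berkovich_seminorm N S}"

definition closed_point :: "('a::field \<Rightarrow> real) \<Rightarrow> 'a \<Rightarrow> 'a poly \<Rightarrow> real" where
  "closed_point N x = (\<lambda>p. N (poly p x))"

lemma topspace_berkovich_line: "topspace (berkovich_line N) = {S. berkovich_seminorm N S}"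
  by (simp add: berkovich_line_def)

lemma closed_point_in_berkovich_line:
  assumes "nonarch_norm N"
  shows "closed_point N x \<in> topspace (berkovich_line N)"
proof -
  have *: "0 \<le> N u" "N (u + v) \<le> max (N u) (N v)" "N (u * v) = N u * N v" for u v
    using assms by (auto simp: nonarch_norm_def)
  have "N (u + v) \<le> N u + N v" for u v
    using *(2)[of u v] *(1)[of u] *(1)[of v] by simp
  with * show ?thesis
    by (simp add: topspace_berkovich_line berkovich_seminorm_def closed_point_def)
qed

definition borel_of_topology :: "'b topology \<Rightarrow> 'b measure" where
  "borel_of_topology X = sigma (topspace X) {U. openin X U}"

lemma space_borel_of_topology: "space (borel_of_topology X) = topspace X"
  unfolding borel_of_topology_def by (rule space_measure_of) (auto dest: openin_subset)

lemma sets_borel_of_topology: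
  "sets (borel_of_topology X) = sigma_sets (topspace X) {U. openin X U}"
  unfolding borel_of_topology_def by (rule sets_measure_of) (auto dest: openin_subset)

text \<open>Radon measures in the sense of Folland. For finite measures on a Hausdorff space this amounts
  to inner regularity on all Borel sets.\<close>

definition radon_measure :: "'b topology \<Rightarrow> 'b measure \<Rightarrow> bool" where
  "radon_measure X M \<longleftrightarrow>
     sets M = sets (borel_of_topology X) \<and>
     (\<forall>C. compactin X C \<longrightarrow> emeasure M C < \<infinity>) \<and>
     (\<forall>A\<in>sets M. emeasure M A = (INF U\<in>{U. openin X U \<and> A \<subseteq> U}. emeasure M U)) \<and>
     (\<forall>U. openin X U \<longrightarrow> emeasure M U = (SUP C\<in>{C. compactin X C \<and> C \<subseteq> U}. emeasure M C))"

definition compactly_supported_continuous :: "'b topology \<Rightarrow> ('b \<Rightarrow> real) \<Rightarrow> bool" where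
  "compactly_supported_continuous X h \<longleftrightarrow>
     continuous_map X euclideanreal h \<and>
     compactin X (X closure_of {p \<in> topspace X. h p \<noteq> 0})"

definition weakly_converges ::
    "'b topology \<Rightarrow> (nat \<Rightarrow> 'b measure) \<Rightarrow> 'b measure \<Rightarrow> bool" where
  "weakly_converges X \<mu> \<rho> \<longleftrightarrow>
     (\<forall>h. compactly_supported_continuous X h \<longrightarrow>
        (\<lambda>n. integral\<^sup>L (\<mu> n) h) \<longlonglongrightarrow> integral\<^sup>L \<rho> h)"

definition poly_iterate :: "'a::field poly \<Rightarrow> nat \<Rightarrow> 'a poly" where
  "poly_iterate f n = ((\<lambda>g. f \<circ>\<^sub>p g) ^^ n) [:0, 1:]"

lemma poly_poly_iterate: "poly (poly_iterate f n) y = (poly f ^^ n) y"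
  by (induction n) (simp_all add: poly_iterate_def poly_pcompose)

lemma degree_poly_iterate: "degree (poly_iterate f n) = degree f ^ n"
  by (induction n) (simp_all add: poly_iterate_def degree_pcompose)

definition point_mass :: "('a::field \<Rightarrow> real) \<Rightarrow> 'a \<Rightarrow> ('a poly \<Rightarrow> real) measure" where
  "point_mass N x = return (borel_of_topology (berkovich_line N)) (closed_point N x)"

text \<open>
  The sum over \<open>g y = x\<close> of \<open>\<delta>\<^sub>y\<close> with multiplicities, as the image on the Berkovich line of the
  measure on the fibre with weight \<open>order y (g - x)\<close> at \<open>y\<close>.
\<close>

definition pullback_point_mass ::
    "('a::field \<Rightarrow> real) \<Rightarrow> 'a poly \<Rightarrow> 'a \<Rightarrow> ('a poly \<Rightarrow> real) measure" where
  "pullback_point_mass N g x =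
     distr (point_measure {y. poly g y = x} (\<lambda>y. of_nat (order y (g - [:x:]))))
       (borel_of_topology (berkovich_line N)) (closed_point N)"

lemma emeasure_pullback_point_mass:
  assumes N: "nonarch_norm N" and g: "degree g > 0"
    and A: "A \<in> sets (borel_of_topology (berkovich_line N))"
  shows "emeasure (pullback_point_mass N g x) A =
    (\<Sum>y | poly g y = x. of_nat (order y (g - [:x:])) * emeasure (point_mass N y) A)"
proof -
  let ?F = "{y. poly g y = x}"
  let ?w = "\<lambda>y. of_nat (order y (g - [:x:])) :: ennreal"
  have "g - [:x:] \<noteq> 0" using g by auto
  then have "finite {y. poly (g - [:x:]) y = 0}" by (rule poly_roots_finite)
  then have fin: "finite ?F" by simp
  have meas: "closed_point N \<in> measurable (point_measure ?F ?w) (borel_of_topology (berkovich_line N))"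
    using closed_point_in_berkovich_line[OF N]
    by (simp add: measurable_point_measure_eq1 space_borel_of_topology)
  have "emeasure (pullback_point_mass N g x) A = emeasure (point_measure ?F ?w) (closed_point N -` A \<inter> ?F)"
    unfolding pullback_point_mass_def by (simp add: emeasure_distr[OF meas A] space_point_measure)
  also have "\<dots> = (\<Sum>y \<in> closed_point N -` A \<inter> ?F. ?w y)"
    using fin by (intro emeasure_point_measure_finite) auto
  also have "\<dots> = (\<Sum>y\<in>?F. ?w y * emeasure (point_mass N y) A)"
    using fin A by (intro sum.mono_neutral_cong_left) (auto simp: point_mass_def indicator_def)
  finally show ?thesis .
qed

text \<open>The measure \<open>d\<^sup>-\<^sup>n f\<^sup>n\<^sup>* \<delta>\<^sub>x\<close>, where \<open>d\<close> is the degree of \<open>f\<close>.\<close>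

definition normalized_pullback ::
    "('a::field \<Rightarrow> real) \<Rightarrow> 'a poly \<Rightarrow> 'a \<Rightarrow> nat \<Rightarrow> ('a poly \<Rightarrow> real) measure" where
  "normalized_pullback N f x n =
     scale_measure (ennreal (1 / real (degree f) ^ n)) (pullback_point_mass N (poly_iterate f n) x)"

text \<open>\<open>R = K[z]\<close>: every regular function is a polynomial in \<open>z\<close>. Composition with a constant only
  yields constants, so such a \<open>z\<close> is automatically transcendental over \<open>K\<close>.\<close>

definition global_coordinate :: "'a::field poly \<Rightarrow> bool" where
  "global_coordinate z \<longleftrightarrow> (\<forall>p. \<exists>q. p = q \<circ>\<^sub>p z)"

text \<open>In the coordinate \<open>z\<close> the map is \<open>z \<mapsto> z\<^sup>d\<close>: the pullback \<open>z \<circ> f\<close> of \<open>z\<close> equals \<open>z\<^sup>d\<close>.\<close>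

definition is_power_map_in :: "'a::field poly \<Rightarrow> 'a poly \<Rightarrow> bool" where
  "is_power_map_in z f \<longleftrightarrow> z \<circ>\<^sub>p f = z ^ degree f"

end

theory Submission
  imports Defs
begin

text \<open>
  The integral of \<open>log max |z - a| r\<close> against \<open>d\<^sup>-\<^sup>n f\<^sup>n\<^sup>* \<delta>\<^sub>x\<close> is, up to the leading coefficient,
  \<open>d\<^sup>-\<^sup>n log |f\<^sup>n - x|\<close> evaluated at the Gauss norm of the disc \<open>D(a, r)\<close>. If the orbit of the disc
  escapes to infinity, the limit of this quantity visibly does not depend on \<open>x\<close>. If the orbit is
  bounded, the limit is \<open>0\<close>: the trivial lower bound \<open>-C\<close> at the preimages of \<open>x\<close> under \<open>f\<^sup>k\<close>
  improves to \<open>-C e\<^sub>k / d\<^sup>k\<close> at \<open>x\<close>, where \<open>e\<^sub>k\<close> is the largest multiplicity of such a preimage, and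
  in characteristic zero \<open>e\<^sub>k / d\<^sup>k\<close> tends to \<open>0\<close> unless \<open>x\<close> is totally invariant. The functions
  \<open>u (|z - a|)\<close> are limits of combinations of \<open>log max |z - a| r\<close>, and by the ultrametric inequality
  their span is an algebra, so Stone-Weierstrass gives convergence for all continuous functions.
  The limit is a positive functional, and the Riesz representation theorem turns it into \<open>\<rho>\<close>.
\<close>

section \<open>The Riesz representation theorem\<close>

text \<open>The obstacle is compactness. \<open>K\<close> itself is in general not locally compact,
  whereas the seminorms with bounded value at the coordinate form a compact set. Approximation by
  radial functions takes place on that set and is then restricted to closed points. All iterated
  preimages of one point lie in a single ball, because points farther out escape to infinity. Hence
  no mass is lost: the means converge for every continuous function, and the limit functional is
  carried by a compact set and has total mass 1. Multiplicities are controlled through the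
  derivative. In characteristic zero a totally ramified point is the only zero of the derivative, so
  there is at most one. Over a point that is not totally invariant two consecutive backward steps
  are therefore never both totally ramified, and at least every second step gains a factor
  \<open>(d - 1) / d\<close>.\<close>

lemma continuous_map_imp_borel_measurable:
  assumes "continuous_map X euclideanreal h" "sets M = sets (borel_of_topology X)"
  shows "h \<in> borel_measurable M"
proof (rule borel_measurableI)
  fix S :: "real set" assume "open S"
  then have "openin X {x \<in> topspace X. h x \<in> S}"
    using assms(1) openin_continuous_map_preimage[of X euclideanreal h S] by simp
  moreover have "space M = topspace X"
    using sets_eq_imp_space_eq[OF assms(2)] by (simp add: space_borel_of_topology)
  then have "h -` S \<inter> space M = {x \<in> topspace X. h x \<in> S}" by auto
  ultimately show "h -` S \<inter> space M \<in> sets M"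
    by (simp add: assms(2) sets_borel_of_topology sigma_sets.Basic)
qed

text \<open>The \<open>k\<close>-th summand is the part of \<open>t\<close> between the heights
  \<open>k\<close> and \<open>k + 1\<close>. It serves to cut a function into horizontal
  layers.\<close>

lemma sum_unit_layers:
  fixes t :: real
  assumes "0 \<le> t"
  shows "(\<Sum>k<n. min 1 (max 0 (t - real k))) = min t (real n)"
  using assms by (induction n) auto

text \<open>Complete regularity supplies the bump functions. The compact set \<open>Z\<close>
  carries the functional, which takes the place of a restriction to compactly supported functions:
  \<open>\<Lambda>\<close> lives on all continuous functions, bounded or not.\<close>

locale probability_functional =
  fixes X :: "'b topology" and Z :: "'b set" and \<Lambda> :: "('b \<Rightarrow> real) \<Rightarrow> real"
  assumes completely_regular: "completely_regular_space X"
    and Hausdorff: "Hausdorff_space X"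
    and compact_support: "compactin X Z"
    and add: "\<And>g h. continuous_map X euclideanreal g \<Longrightarrow> continuous_map X euclideanreal h \<Longrightarrow>
      \<Lambda> (\<lambda>x. g x + h x) = \<Lambda> g + \<Lambda> h"
    and scale: "\<And>c h. continuous_map X euclideanreal h \<Longrightarrow> \<Lambda> (\<lambda>x. c * h x) = c * \<Lambda> h"
    and one: "\<Lambda> (\<lambda>_. 1) = 1"
    and nonneg: "\<And>h. continuous_map X euclideanreal h \<Longrightarrow> (\<And>x. x \<in> Z \<Longrightarrow> 0 \<le> h x) \<Longrightarrow> 0 \<le> \<Lambda> h"
begin

section \<open>Linearity and monotonicity of the functional\<close>

lemma const: "\<Lambda> (\<lambda>_. c) = c"
  using scale[of "\<lambda>_. 1" c] one by simp

lemma mono: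
  assumes g: "continuous_map X euclideanreal g" and h: "continuous_map X euclideanreal h"
    and le: "\<And>x. x \<in> Z \<Longrightarrow> g x \<le> h x"
  shows "\<Lambda> g \<le> \<Lambda> h"
proof -
  have "0 \<le> \<Lambda> (\<lambda>x. h x + (-1) * g x)"
    by (rule nonneg) (use g h le in \<open>auto intro!: continuous_intros\<close>)
  also have "\<dots> = \<Lambda> h + (-1) * \<Lambda> g"
    using g h by (subst add) (auto intro!: continuous_intros simp: scale[of g "-1", simplified])
  finally show ?thesis by simp
qed

lemma sum:
  assumes "finite I" and "\<And>i. i \<in> I \<Longrightarrow> continuous_map X euclideanreal (g i)"
  shows "\<Lambda> (\<lambda>x. \<Sum>i\<in>I. g i x) = (\<Sum>i\<in>I. \<Lambda> (g i))"
  using assms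
proof (induction I rule: finite_induct)
  case empty then show ?case by (simp add: const)
next
  case (insert i I)
  then have "\<Lambda> (\<lambda>x. g i x + (\<Sum>i\<in>I. g i x)) = \<Lambda> (g i) + \<Lambda> (\<lambda>x. \<Sum>i\<in>I. g i x)"
    by (intro add continuous_map_sum) auto
  with insert show ?case by simp
qed

text \<open>Vanishing outside \<open>U\<close> replaces the usual condition of a compact support
  inside \<open>U\<close>. Compactness comes back through the superlevel sets of \<open>h\<close>
  intersected with \<open>Z\<close>.\<close>

definition subordinate :: "'b set \<Rightarrow> ('b \<Rightarrow> real) \<Rightarrow> bool" where
  "subordinate U h \<longleftrightarrow> continuous_map X euclideanreal h \<and>
     (\<forall>x\<in>topspace X. 0 \<le> h x \<and> h x \<le> 1) \<and> (\<forall>x\<in>topspace X - U. h x = 0)"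

lemma subordinate_continuous: "subordinate U h \<Longrightarrow> continuous_map X euclideanreal h"
  unfolding subordinate_def by blast

lemma subordinate_bounds:
  assumes "subordinate U h" "x \<in> topspace X"
  shows "0 \<le> h x" "h x \<le> 1" "x \<notin> U \<Longrightarrow> h x = 0"
  using assms by (auto simp: subordinate_def)

section \<open>The mass of open sets and the outer measure it generates\<close>

definition open_mass :: "'b set \<Rightarrow> ennreal" where
  "open_mass U = (SUP h\<in>{h. subordinate U h}. ennreal (\<Lambda> h))"

definition outer_mass :: "'b set \<Rightarrow> ennreal" where
  "outer_mass A = (INF U\<in>{U. openin X U \<and> A \<subseteq> U}. open_mass U)"

lemma Z_subset: "Z \<subseteq> topspace X"
  by (rule compactin_subset_topspace[OF compact_support])

lemma open_mass_upper: "subordinate U h \<Longrightarrow> ennreal (\<Lambda> h) \<le> open_mass U"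
  unfolding open_mass_def by (rule SUP_upper) simp

lemma open_mass_least: "(\<And>h. subordinate U h \<Longrightarrow> ennreal (\<Lambda> h) \<le> c) \<Longrightarrow> open_mass U \<le> c"
  unfolding open_mass_def by (rule SUP_least) simp

lemma subordinate_zero: "subordinate U (\<lambda>_. 0)"
  by (simp add: subordinate_def)

lemma subordinate_mono: "subordinate U h \<Longrightarrow> U \<subseteq> V \<Longrightarrow> subordinate V h"
  by (auto simp: subordinate_def)

lemma subordinate_le:
  assumes "subordinate U h" "\<And>x. x \<in> Z \<Longrightarrow> h x \<le> c"
  shows "\<Lambda> h \<le> c"
  using mono[of h "\<lambda>_. c"] assms by (simp add: const subordinate_def)

lemma subordinate_nonneg: "subordinate U h \<Longrightarrow> 0 \<le> \<Lambda> h"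
  using Z_subset by (intro nonneg) (auto simp: subordinate_def)

lemma subordinate_le_one:
  assumes "subordinate U h"
  shows "\<Lambda> h \<le> 1"
  by (rule subordinate_le[OF assms]) (use Z_subset subordinate_bounds(2)[OF assms] in blast)

lemma open_mass_le_one: "open_mass U \<le> 1"
  using subordinate_le_one by (intro open_mass_least) simp

lemma subordinate_approx:
  assumes e: "e > 0"
  shows "\<exists>g. subordinate U g \<and> open_mass U \<le> ennreal (\<Lambda> g + e)"
\<comment> \<open>The zero function settles small masses. Otherwise the mass exceeds
  \<open>e\<close>, and \<open>ennreal\<close> does not truncate the difference.\<close>
proof (cases "open_mass U \<le> ennreal e")
  case True
  then show ?thesis using subordinate_zero[of U] by (intro exI[of _ "\<lambda>_. 0"]) (simp add: const)
next
  case False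
  obtain r where r: "open_mass U = ennreal r" "r \<ge> 0"
    using open_mass_le_one[of U] by (cases "open_mass U") (auto simp: top_unique)
  with False e have "ennreal (r - e) < open_mass U" by (auto simp: ennreal_less_iff)
  then obtain g where g: "subordinate U g" "ennreal (r - e) < ennreal (\<Lambda> g)"
    unfolding open_mass_def less_SUP_iff by auto
  then have "r - e < \<Lambda> g" by (meson ennreal_leI leI less_le_not_le)
  then show ?thesis using g r by (intro exI[of _ g]) (auto intro!: ennreal_leI)
qed

lemma open_mass_mono: "U \<subseteq> V \<Longrightarrow> open_mass U \<le> open_mass V"
  by (intro open_mass_least open_mass_upper) (rule subordinate_mono)

lemma open_mass_empty: "open_mass {} = 0"
proof -
  have "\<Lambda> h \<le> 0" if "subordinate {} h" for h
    by (rule subordinate_le[OF that]) (use that Z_subset in \<open>auto simp: subordinate_def\<close>)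
  then have "open_mass {} \<le> 0" by (intro open_mass_least) (simp add: ennreal_neg)
  then show ?thesis by simp
qed

lemma open_mass_space: "open_mass (topspace X) = 1"
proof (rule antisym[OF open_mass_le_one])
  have "subordinate (topspace X) (\<lambda>_. 1)" by (simp add: subordinate_def)
  from open_mass_upper[OF this] show "1 \<le> open_mass (topspace X)" by (simp add: one)
qed

lemma open_mass_off_support: "open_mass (topspace X - Z) = 0"
proof -
  have "\<Lambda> h \<le> 0" if "subordinate (topspace X - Z) h" for h
    by (rule subordinate_le[OF that]) (use that Z_subset in \<open>auto simp: subordinate_def\<close>)
  then have "open_mass (topspace X - Z) \<le> 0" by (intro open_mass_least) (simp add: ennreal_neg)
  then show ?thesis by simp
qed

lemma compactin_superlevel:
  assumes "continuous_map X euclideanreal h"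
  shows "compactin X (Z \<inter> {x \<in> topspace X. e \<le> h x})"
  using assms closedin_continuous_map_preimage[of X euclideanreal h "{e..}"]
  by (intro compact_Int_closedin compact_support) (auto simp: vimage_def)

lemma openin_superlevel:
  assumes "continuous_map X euclideanreal h"
  shows "openin X {x \<in> topspace X. e < h x}"
  using assms openin_continuous_map_preimage[of X euclideanreal h "{e<..}"] by auto

lemma openin_sublevel:
  assumes "continuous_map X euclideanreal h"
  shows "openin X {x \<in> topspace X. h x < e}"
  using assms openin_continuous_map_preimage[of X euclideanreal h "{..<e}"] by auto

lemma exists_subordinate:
  assumes "openin X U" "x \<in> U"
  shows "\<exists>g. subordinate U g \<and> g x = 1"
proof -
  obtain f where f: "continuous_map X euclideanreal f" "f x = 0" "f ` (topspace X - U) \<subseteq> {1::real}"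
    using completely_regular assms unfolding completely_regular_space_alt' by blast
  have "subordinate U (\<lambda>x. min 1 (max 0 (1 - f x)))"
    unfolding subordinate_def using f(3)
    by (auto intro!: continuous_map_real_min continuous_map_real_max continuous_map_diff f(1))
  with f show ?thesis by (intro exI[of _ "\<lambda>x. min 1 (max 0 (1 - f x))"]) auto
qed

text \<open>The part of \<open>Z\<close> where \<open>h\<close> is at least \<open>e\<close> is
  compact, so finitely many bumps cover it. Grouping the bumps by the index of the set that contains
  them splits \<open>h\<close>, up to \<open>e\<close>, into functions subordinate to the single
  \<open>U i\<close>.\<close>

lemma open_mass_countably_subadditive:
  fixes U :: "nat \<Rightarrow> 'b set"
  assumes U: "\<And>i. openin X (U i)"
  shows "open_mass (\<Union>i. U i) \<le> (\<Sum>i. open_mass (U i))"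
proof (rule open_mass_least, rule ennreal_le_epsilon)
  fix h and e :: real
  assume h: "subordinate (\<Union>i. U i) h" and e: "0 < e"
  note hc = subordinate_continuous[OF h]
  define K where "K = Z \<inter> {x \<in> topspace X. e \<le> h x}"
  have K: "compactin X K" unfolding K_def by (rule compactin_superlevel[OF hc])
  have "\<exists>p. subordinate (U (fst p)) (snd p) \<and> snd p x = 1" if "x \<in> K" for x
  proof -
    from that e have "h x \<noteq> 0" "x \<in> topspace X" by (auto simp: K_def)
    with h have "x \<in> (\<Union>i. U i)" using subordinate_bounds(3) by blast
    then obtain i g where "subordinate (U i) g" "g x = 1" using exists_subordinate U by blast
    then show ?thesis by (intro exI[of _ "(i, g)"]) simp
  qed
  then obtain P where P: "\<forall>x\<in>K. subordinate (U (fst (P x))) (snd (P x)) \<and> snd (P x) x = 1"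
    by (metis bchoice)
  define idx where "idx x = fst (P x)" for x
  define G where "G x = snd (P x)" for x
  have G: "subordinate (U (idx x)) (G x)" "G x x = 1" if "x \<in> K" for x
    using P that by (auto simp: idx_def G_def)
  \<comment> \<open>On \<open>V x\<close> the bump is within \<open>e\<close> of 1, hence at least
    \<open>h - e\<close>.\<close>
  define V where "V x = {y \<in> topspace X. 1 - e < G x y}" for x
  have "\<exists>D. finite D \<and> D \<subseteq> V ` K \<and> K \<subseteq> \<Union>D"
  proof (rule compactinD[OF K])
    show "openin X W" if "W \<in> V ` K" for W
      using that G(1) by (auto simp: V_def intro!: openin_superlevel subordinate_continuous)
    show "K \<subseteq> \<Union>(V ` K)" using G(2) e compactin_subset_topspace[OF K] by (auto simp: V_def)
  qed
  then obtain D where D: "finite D" "D \<subseteq> K" "K \<subseteq> (\<Union>x\<in>D. V x)"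
    by (metis (no_types, lifting) finite_subset_image)
  \<comment> \<open>Several bumps may belong to the same \<open>U i\<close>; truncation at 1 keeps
    their sum subordinate.\<close>
  define Q where "Q i y = min 1 (\<Sum>x\<in>{x\<in>D. idx x = i}. G x y)" for i y
  have Gnn: "0 \<le> G x y" if "x \<in> D" "y \<in> topspace X" for x y
    using that D G by (meson subsetD subordinate_bounds(1))
  have Q: "subordinate (U i) (Q i)" for i
    unfolding subordinate_def
  proof (intro conjI ballI)
    show "continuous_map X euclideanreal (Q i)"
      unfolding Q_def using D G(1)
      by (intro continuous_map_real_min continuous_map_sum) (auto intro!: subordinate_continuous)
    show "Q i y = 0" if y: "y \<in> topspace X - U i" for y
    proof -
      have "G x y = 0" if x: "x \<in> {x\<in>D. idx x = i}" for x
        using x y D(2) subordinate_bounds(3)[OF G(1)[of x], of y] by blast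
      then show ?thesis by (simp add: Q_def)
    qed
  qed (auto simp: Q_def intro!: sum_nonneg Gnn)
  let ?I = "idx ` D"
  have le: "h y \<le> (\<Sum>i\<in>?I. Q i y) + e" if y: "y \<in> Z" for y
  proof -
    have yX: "y \<in> topspace X" using y Z_subset by auto
    have nn: "0 \<le> (\<Sum>i\<in>?I. Q i y)" by (intro sum_nonneg subordinate_bounds(1)[OF Q yX])
    show ?thesis
    proof (cases "e \<le> h y")
      case True
      then obtain x where x: "x \<in> D" "y \<in> V x" using D y yX by (auto simp: K_def)
      have "1 - e \<le> Q (idx x) y"
      proof -
        have "G x y \<le> (\<Sum>x'\<in>{x'\<in>D. idx x' = idx x}. G x' y)"
          using x D yX Gnn by (intro member_le_sum) auto
        with x e show ?thesis by (auto simp: Q_def V_def)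
      qed
      also have "\<dots> \<le> (\<Sum>i\<in>?I. Q i y)"
        using x D subordinate_bounds(1)[OF Q yX] by (intro member_le_sum) auto
      finally show ?thesis using subordinate_bounds(2)[OF h yX] by simp
    qed (use nn in auto)
  qed
  have Qc: "continuous_map X euclideanreal (Q i)" for i by (rule subordinate_continuous[OF Q])
  have "\<Lambda> h \<le> \<Lambda> (\<lambda>y. (\<Sum>i\<in>?I. Q i y) + e)"
    using hc Qc D le by (intro mono continuous_map_add continuous_map_sum) auto
  also have "\<dots> = (\<Sum>i\<in>?I. \<Lambda> (Q i)) + e"
    using D Qc by (subst add) (auto simp: sum const intro!: continuous_map_sum)
  finally have "ennreal (\<Lambda> h) \<le> ennreal (\<Sum>i\<in>?I. \<Lambda> (Q i)) + ennreal e"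
    using e Q by (subst ennreal_plus[symmetric]) (auto intro!: ennreal_leI sum_nonneg subordinate_nonneg)
  also have "ennreal (\<Sum>i\<in>?I. \<Lambda> (Q i)) = (\<Sum>i\<in>?I. ennreal (\<Lambda> (Q i)))"
    using Q by (intro sum_ennreal[symmetric] subordinate_nonneg)
  also have "\<dots> \<le> (\<Sum>i\<in>?I. open_mass (U i))"
    using Q by (intro sum_mono open_mass_upper)
  also have "\<dots> \<le> (\<Sum>i. open_mass (U i))"
    using D by (intro sum_le_suminf) auto
  finally show "ennreal (\<Lambda> h) \<le> (\<Sum>i. open_mass (U i)) + ennreal e"
    by (simp add: add_right_mono)
qed

lemma outer_mass_open: "openin X U \<Longrightarrow> outer_mass U = open_mass U"
  unfolding outer_mass_def
  by (intro antisym INF_lower INF_greatest) (auto intro: open_mass_mono)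

lemma outer_mass_mono: "A \<subseteq> B \<Longrightarrow> outer_mass A \<le> outer_mass B"
  unfolding outer_mass_def by (rule INF_superset_mono) auto

lemma outer_mass_lower: "openin X U \<Longrightarrow> A \<subseteq> U \<Longrightarrow> outer_mass A \<le> open_mass U"
  unfolding outer_mass_def by (rule INF_lower) simp

lemma outer_measure_space_outer_mass: "outer_measure_space (Pow (topspace X)) outer_mass"
  unfolding outer_measure_space_def
proof (intro conjI)
  show "positive (Pow (topspace X)) outer_mass"
    by (simp add: positive_def outer_mass_open open_mass_empty)
  show "increasing (Pow (topspace X)) outer_mass"
    by (auto simp: increasing_def intro: outer_mass_mono)
  show "countably_subadditive (Pow (topspace X)) outer_mass"
  proof (unfold countably_subadditive_def, intro allI impI, rule ennreal_le_epsilon)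
    fix A :: "nat \<Rightarrow> 'b set" and e :: real
    assume A: "range A \<subseteq> Pow (topspace X)" and e: "0 < e"
    have "\<exists>U. openin X U \<and> A i \<subseteq> U \<and> open_mass U \<le> outer_mass (A i) + ennreal (e * (1/2) ^ Suc i)" for i
    proof -
      have "outer_mass (A i) \<le> open_mass (topspace X)"
        by (rule outer_mass_lower) (use A in auto)
      then have "outer_mass (A i) \<noteq> top" by (auto simp: open_mass_space top_unique)
      then have "outer_mass (A i) < outer_mass (A i) + ennreal (e * (1/2) ^ Suc i)"
        using e by (cases "outer_mass (A i)") (auto simp: ennreal_plus[symmetric] ennreal_less_iff simp del: ennreal_plus)
      then show ?thesis
        unfolding outer_mass_def[of "A i"] INF_less_iff by (auto simp: less_imp_le)
    qed
    then obtain U where U: "\<And>i. openin X (U i)" "\<And>i. A i \<subseteq> U i"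
      "\<And>i. open_mass (U i) \<le> outer_mass (A i) + ennreal (e * (1/2) ^ Suc i)" by metis
    have "outer_mass (\<Union>i. A i) \<le> open_mass (\<Union>i. U i)"
      using U by (intro outer_mass_lower openin_Union) auto
    also have "\<dots> \<le> (\<Sum>i. open_mass (U i))"
      by (rule open_mass_countably_subadditive) (rule U)
    also have "\<dots> \<le> (\<Sum>i. outer_mass (A i) + ennreal (e * (1/2) ^ Suc i))"
      using U by (intro suminf_le) auto
    also have "\<dots> = (\<Sum>i. outer_mass (A i)) + (\<Sum>i. ennreal (e * (1/2) ^ Suc i))"
      by (intro suminf_add[symmetric]) auto
    also have "(\<Sum>i. ennreal (e * (1/2) ^ Suc i)) = ennreal e"
    proof -
      have "(\<lambda>i. e * (1/2) ^ Suc i) sums (e * 1)"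
        by (intro sums_mult power_half_series)
      then show ?thesis using e by (intro suminf_ennreal_eq) auto
    qed
    finally show "outer_mass (\<Union> (range A)) \<le> (\<Sum>i. outer_mass (A i)) + ennreal e" .
  qed
qed

section \<open>Caratheodory measurability of open sets\<close>

lemma subordinate_add:
  assumes h: "subordinate (V \<inter> U) h" and e: "e > 0"
    and g: "subordinate (V \<inter> {x \<in> topspace X. h x < e}) g"
  shows "\<Lambda> h + \<Lambda> g \<le> (1 + e) * \<Lambda> (\<lambda>x. (h x + g x) / (1 + e))"
    and "subordinate V (\<lambda>x. (h x + g x) / (1 + e))"
proof -
  note c = subordinate_continuous[OF h] subordinate_continuous[OF g]
  have s: "continuous_map X euclideanreal (\<lambda>x. h x + g x)" by (intro continuous_map_add c)
  have "\<Lambda> (\<lambda>x. (1 / (1 + e)) * (h x + g x)) = (1 / (1 + e)) * (\<Lambda> h + \<Lambda> g)"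
    unfolding scale[OF s] add[OF c] ..
  then show "\<Lambda> h + \<Lambda> g \<le> (1 + e) * \<Lambda> (\<lambda>x. (h x + g x) / (1 + e))"
    using e by simp
  \<comment> \<open>Where \<open>h x\<close> is at least \<open>e\<close>, \<open>g\<close> vanishes
    and the sum is at most 1; elsewhere it is at most \<open>e + 1\<close>.\<close>
  have bnd: "0 \<le> h x + g x" "h x + g x \<le> 1 + e" if "x \<in> topspace X" for x
    using subordinate_bounds[OF h that] subordinate_bounds[OF g that] that e by (cases "h x < e"; auto)+
  have "continuous_map X euclideanreal (\<lambda>x. (h x + g x) / (1 + e))"
    using e by (intro continuous_map_real_divide s continuous_map_const[THEN iffD2]) auto
  moreover have "(h x + g x) / (1 + e) = 0" if "x \<in> topspace X - V" for x
    using subordinate_bounds(3)[OF h] subordinate_bounds(3)[OF g] that by simp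
  moreover have "0 \<le> (h x + g x) / (1 + e)" "(h x + g x) / (1 + e) \<le> 1" if "x \<in> topspace X" for x
    using bnd[OF that] e by simp_all
  ultimately show "subordinate V (\<lambda>x. (h x + g x) / (1 + e))"
    unfolding subordinate_def by blast
qed

text \<open>Take \<open>h\<close> nearly attaining the mass of \<open>V \<inter> U\<close>. The
  remainder \<open>V - U\<close> lies in the open set where \<open>h < e\<close>, and a function
  subordinate to that set can be added to \<open>h\<close> at the price of a factor
  \<open>1 + e\<close>.\<close>

lemma open_mass_split:
  assumes V: "openin X V"
  shows "open_mass (V \<inter> U) + outer_mass (V - U) \<le> open_mass V"
proof (rule ennreal_le_epsilon)
  fix e' :: real assume "0 < e'"
  \<comment> \<open>One third for each of the two suprema, one for the factor
    \<open>1 + e\<close>.\<close>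
  define e where "e = e' / 3"
  have e: "e > 0" "e' = 3 * e" using \<open>0 < e'\<close> by (auto simp: e_def)
  obtain h where h: "subordinate (V \<inter> U) h" "open_mass (V \<inter> U) \<le> ennreal (\<Lambda> h + e)"
    using subordinate_approx[OF e(1)] by blast
  note c = subordinate_continuous[OF h(1)]
  let ?W = "V \<inter> {x \<in> topspace X. h x < e}"
  have W: "openin X ?W" using V openin_sublevel[OF c] by (rule openin_Int)
  obtain g where g: "subordinate ?W g" "open_mass ?W \<le> ennreal (\<Lambda> g + e)"
    using subordinate_approx[OF e(1)] by blast
  let ?k = "\<lambda>x. (h x + g x) / (1 + e)"
  note k = subordinate_add[OF h(1) e(1) g(1)]
  have "\<Lambda> ?k \<le> 1" by (rule subordinate_le_one[OF k(2)])
  then have "e * \<Lambda> ?k \<le> e" using e(1) by (simp add: mult_left_le)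
  with k(1) have *: "\<Lambda> h + \<Lambda> g \<le> \<Lambda> ?k + e" by (simp only: distrib_right)
  have "h x = 0" if "x \<in> V - U" for x
    using subordinate_bounds(3)[OF h(1), of x] that openin_subset[OF V] by blast
  then have "V - U \<subseteq> ?W" using openin_subset[OF V] e(1) by auto
  then have "outer_mass (V - U) \<le> open_mass ?W" using W by (intro outer_mass_lower)
  then have "open_mass (V \<inter> U) + outer_mass (V - U) \<le> ennreal (\<Lambda> h + e) + ennreal (\<Lambda> g + e)"
    using h(2) g(2) by (intro add_mono) auto
  also have "\<dots> = ennreal (\<Lambda> h + e + (\<Lambda> g + e))"
    using subordinate_nonneg[OF h(1)] subordinate_nonneg[OF g(1)] e
    by (intro ennreal_plus[symmetric]) auto
  also have "\<dots> \<le> ennreal (\<Lambda> ?k + e')" using * e by (intro ennreal_leI) auto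
  also have "\<dots> = ennreal (\<Lambda> ?k) + ennreal e'"
    using subordinate_nonneg[OF k(2)] e by (intro ennreal_plus) auto
  also have "\<dots> \<le> open_mass V + ennreal e'" by (intro add_right_mono open_mass_upper k(2))
  finally show "open_mass (V \<inter> U) + outer_mass (V - U) \<le> open_mass V + ennreal e'" .
qed

text \<open>Outer regularity of \<open>outer_mass\<close> holds by definition, so the condition on
  an arbitrary \<open>A\<close> reduces to \<open>open_mass_split\<close> for open \<open>V\<close>
  around \<open>A\<close>.\<close>

lemma openin_in_lambda_system:
  assumes U: "openin X U"
  shows "U \<in> lambda_system (topspace X) (Pow (topspace X)) outer_mass"
proof -
  interpret sigma_algebra "topspace X" "Pow (topspace X)" by (rule sigma_algebra_Pow)
  have "outer_mass (A \<inter> U) + outer_mass (A - U) = outer_mass A" if A: "A \<subseteq> topspace X" for A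
  proof (rule antisym)
    show "outer_mass (A \<inter> U) + outer_mass (A - U) \<le> outer_mass A"
      unfolding outer_mass_def[of A]
    proof (rule INF_greatest)
      fix V assume "V \<in> {U. openin X U \<and> A \<subseteq> U}"
      then have V: "openin X V" "A \<subseteq> V" by auto
      have "outer_mass (A \<inter> U) + outer_mass (A - U) \<le> open_mass (V \<inter> U) + outer_mass (V - U)"
        using V U by (intro add_mono outer_mass_lower outer_mass_mono openin_Int) auto
      also have "\<dots> \<le> open_mass V" by (rule open_mass_split[OF V(1)])
      finally show "outer_mass (A \<inter> U) + outer_mass (A - U) \<le> open_mass V" .
    qed
    have "subadditive (Pow (topspace X)) outer_mass"
      using outer_measure_space_outer_mass
      by (intro countably_subadditive_subadditive) (auto simp: outer_measure_space_def)
    from subadditiveD[OF this, of "A \<inter> U" "A - U"] A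
    show "outer_mass A \<le> outer_mass (A \<inter> U) + outer_mass (A - U)"
      by (simp add: Int_Diff_Un Int_Diff_disjoint Int_ac) blast
  qed
  then show ?thesis using openin_subset[OF U] by (simp add: lambda_system_eq)
qed

section \<open>The measure, its regularity and its integral\<close>

definition riesz_measure :: "'b measure" where
  "riesz_measure = measure_of (topspace X) {U. openin X U} outer_mass"

lemma sets_riesz_measure: "sets riesz_measure = sets (borel_of_topology X)"
  unfolding riesz_measure_def sets_borel_of_topology
  by (rule sets_measure_of) (auto dest: openin_subset)

lemma space_riesz_measure: "space riesz_measure = topspace X"
  unfolding riesz_measure_def by (rule space_measure_of) (auto dest: openin_subset)

lemma openin_sets_riesz_measure: "openin X U \<Longrightarrow> U \<in> sets riesz_measure"
  by (auto simp: sets_riesz_measure sets_borel_of_topology)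

lemma emeasure_riesz_measure:
  assumes "A \<in> sets riesz_measure"
  shows "emeasure riesz_measure A = outer_mass A"
proof -
  interpret P: sigma_algebra "topspace X" "Pow (topspace X)" by (rule sigma_algebra_Pow)
  let ?L = "lambda_system (topspace X) (Pow (topspace X)) outer_mass"
  let ?B = "sigma_sets (topspace X) {U. openin X U}"
  have L: "measure_space (topspace X) ?L outer_mass"
    by (rule P.caratheodory_lemma[OF outer_measure_space_outer_mass])
  then have "?B \<subseteq> ?L"
    by (intro sigma_algebra.sigma_sets_subset) (auto simp: measure_space_def openin_in_lambda_system)
  moreover have "sigma_algebra (topspace X) ?B"
    by (intro sigma_algebra_sigma_sets) (auto dest: openin_subset)
  ultimately have B: "measure_space (topspace X) ?B outer_mass"
    using L measure_down by blast
  show ?thesis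
    by (rule emeasure_measure_of[OF riesz_measure_def])
       (use B assms in \<open>auto dest: openin_subset simp: measure_space_def sets_riesz_measure sets_borel_of_topology\<close>)
qed

lemma emeasure_riesz_measure_open: "openin X U \<Longrightarrow> emeasure riesz_measure U = open_mass U"
  by (simp add: emeasure_riesz_measure openin_sets_riesz_measure outer_mass_open)

lemma prob_space_riesz_measure: "prob_space riesz_measure"
  by (rule prob_spaceI) (simp add: space_riesz_measure emeasure_riesz_measure_open open_mass_space)

lemma closedin_superlevel:
  assumes "continuous_map X euclideanreal h"
  shows "closedin X (Z \<inter> {x \<in> topspace X. e \<le> h x})"
  by (rule compactin_imp_closedin[OF Hausdorff compactin_superlevel[OF assms]])

lemma closedin_sets_riesz_measure: "closedin X C \<Longrightarrow> C \<in> sets riesz_measure"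
  using sets.compl_sets[OF openin_sets_riesz_measure, of "topspace X - C"] closedin_subset[of X C]
  by (simp add: space_riesz_measure closedin_def double_diff)

text \<open>Lowering \<open>h\<close> by \<open>e\<close> and cutting at 0 gives a function that
  vanishes on \<open>Z\<close> off the compact superlevel set. It is subordinate to every open
  neighbourhood of that set enlarged by the null set outside \<open>Z\<close>. This yields inner
  regularity on open sets.\<close>

lemma subordinate_le_emeasure_superlevel:
  assumes h: "subordinate U h" and e: "0 < e"
  shows "ennreal (\<Lambda> h) \<le> emeasure riesz_measure (Z \<inter> {x \<in> topspace X. e \<le> h x}) + ennreal e"
proof -
  note hc = subordinate_continuous[OF h]
  define C where "C = Z \<inter> {x \<in> topspace X. e \<le> h x}"
  define g where "g x = max 0 (h x - e)" for x
  have gc: "continuous_map X euclideanreal g"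
    unfolding g_def by (intro continuous_map_real_max continuous_map_diff hc) auto
  have "\<Lambda> h \<le> \<Lambda> (\<lambda>x. g x + e)"
    by (intro mono hc continuous_map_add gc) (auto simp: g_def)
  also have "\<dots> = \<Lambda> g + e" using gc by (subst add) (auto simp: const)
  finally have hg: "\<Lambda> h \<le> \<Lambda> g + e" .
  have Zc: "openin X (topspace X - Z)"
    using compactin_imp_closedin[OF Hausdorff compact_support] by (simp add: closedin_def)
  have "ennreal (\<Lambda> g) \<le> open_mass W" if W: "openin X W" "C \<subseteq> W" for W
  proof -
    have "subordinate (W \<union> (topspace X - Z)) g"
      unfolding subordinate_def
    proof (intro conjI ballI gc)
      fix x assume x: "x \<in> topspace X"
      show "0 \<le> g x" "g x \<le> 1" using subordinate_bounds[OF h x] e by (auto simp: g_def)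
    next
      fix x assume x: "x \<in> topspace X - (W \<union> (topspace X - Z))"
      then have "\<not> e \<le> h x" using W by (auto simp: C_def)
      then show "g x = 0" by (simp add: g_def)
    qed
    from open_mass_upper[OF this]
    have "ennreal (\<Lambda> g) \<le> emeasure riesz_measure (W \<union> (topspace X - Z))"
      using W Zc by (subst emeasure_riesz_measure_open) auto
    also have "\<dots> \<le> emeasure riesz_measure W + emeasure riesz_measure (topspace X - Z)"
      using W Zc by (intro emeasure_subadditive openin_sets_riesz_measure)
    finally show ?thesis
      using W Zc by (simp add: emeasure_riesz_measure_open open_mass_off_support)
  qed
  then have "ennreal (\<Lambda> g) \<le> outer_mass C"
    unfolding outer_mass_def by (intro INF_greatest) auto
  also have "outer_mass C = emeasure riesz_measure C"
    unfolding C_def by (intro emeasure_riesz_measure[symmetric] closedin_sets_riesz_measure closedin_superlevel hc)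
  finally have "ennreal (\<Lambda> g) \<le> emeasure riesz_measure C" .
  moreover have "ennreal (\<Lambda> h) \<le> ennreal (\<Lambda> g) + ennreal e"
  proof -
    have "0 \<le> \<Lambda> g" by (rule nonneg[OF gc]) (simp add: g_def)
    then show ?thesis using ennreal_leI[OF hg] e by (simp only: ennreal_plus less_imp_le)
  qed
  ultimately show ?thesis unfolding C_def by (meson add_right_mono order_trans)
qed

theorem radon_measure_riesz_measure: "radon_measure X riesz_measure"
  unfolding radon_measure_def
proof (intro conjI allI impI ballI)
  interpret prob_space riesz_measure by (rule prob_space_riesz_measure)
  show "sets riesz_measure = sets (borel_of_topology X)" by (rule sets_riesz_measure)
  show "emeasure riesz_measure C < \<infinity>" for C
    unfolding infinity_ennreal_def by (rule top.not_eq_extremum[THEN iffD1]) (rule emeasure_finite)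
  show "emeasure riesz_measure A = (INF U\<in>{U. openin X U \<and> A \<subseteq> U}. emeasure riesz_measure U)"
    if "A \<in> sets riesz_measure" for A
    unfolding emeasure_riesz_measure[OF that] outer_mass_def
    by (rule INF_cong) (auto simp: emeasure_riesz_measure_open)
  fix U assume U: "openin X U"
  show "emeasure riesz_measure U = (SUP C\<in>{C. compactin X C \<and> C \<subseteq> U}. emeasure riesz_measure C)"
    (is "_ = ?S")
  proof (rule antisym)
    show "?S \<le> emeasure riesz_measure U"
      using U by (intro SUP_least emeasure_mono openin_sets_riesz_measure) auto
    show "emeasure riesz_measure U \<le> ?S"
      unfolding emeasure_riesz_measure_open[OF U]
    proof (rule open_mass_least, rule ennreal_le_epsilon)
      fix h and e :: real assume h: "subordinate U h" and e: "0 < e"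
      let ?C = "Z \<inter> {x \<in> topspace X. e \<le> h x}"
      have "h x \<noteq> 0" if "x \<in> ?C" for x using that e by auto
      then have "?C \<subseteq> U" using subordinate_bounds(3)[OF h] by blast
      then have "emeasure riesz_measure ?C \<le> ?S"
        using compactin_superlevel[OF subordinate_continuous[OF h]] by (intro SUP_upper) auto
      then show "ennreal (\<Lambda> h) \<le> ?S + ennreal e"
        using subordinate_le_emeasure_superlevel[OF h e] by (meson add_right_mono order_trans)
    qed
  qed
qed

lemma integrable_riesz_measure:
  assumes "continuous_map X euclideanreal h" "\<And>x. x \<in> topspace X \<Longrightarrow> \<bar>h x\<bar> \<le> B"
  shows "integrable riesz_measure h"
proof -
  interpret prob_space riesz_measure by (rule prob_space_riesz_measure)
  show ?thesis
    by (intro integrable_const_bound[of _ B] continuous_map_imp_borel_measurable[OF assms(1) sets_riesz_measure])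
       (auto intro!: AE_I2 simp: space_riesz_measure assms(2))
qed

text \<open>Layer cake argument: \<open>n * h\<close> is the sum of the slices \<open>g k\<close>.
  The functional of a slice is at most the measure of \<open>V k\<close>, its integral at least that
  of \<open>V (Suc k)\<close>. Summation shifts the index by one, which costs at most the measure of
  \<open>V 0\<close>, that is 1, before division by \<open>n\<close>.\<close>

lemma functional_le_integral:
  assumes h: "continuous_map X euclideanreal h" and bnd: "\<And>x. x \<in> topspace X \<Longrightarrow> 0 \<le> h x \<and> h x \<le> 1"
  shows "\<Lambda> h \<le> integral\<^sup>L riesz_measure h"
proof (rule field_le_epsilon)
  interpret prob_space riesz_measure by (rule prob_space_riesz_measure)
  fix e :: real assume "0 < e"
  then obtain n :: nat where n: "n > 0" "1 / real n < e"
    using nat_approx_posE by (metis zero_less_Suc)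
  define g where "g k x = min 1 (max 0 (real n * h x - real k))" for k x
  define V where "V k = {x \<in> topspace X. real k / real n < h x}" for k
  have V: "openin X (V k)" for k unfolding V_def by (rule openin_superlevel[OF h])
  have gc: "continuous_map X euclideanreal (g k)" for k
    unfolding g_def
    by (intro continuous_map_real_min continuous_map_real_max continuous_map_diff continuous_map_real_mult_left h) auto
  have gbnd: "0 \<le> g k x" "g k x \<le> 1" for k x by (auto simp: g_def)
  have gint: "integrable riesz_measure (g k)" for k
    by (rule integrable_riesz_measure[OF gc, of _ 1]) (use gbnd in auto)
  have sumg: "(\<Sum>k<n. g k x) = real n * h x" if "x \<in> topspace X" for x
    using bnd[OF that] sum_unit_layers[of "real n * h x" n] unfolding g_def
    by (simp add: min_absorb1 mult_left_le)
  have Vg: "subordinate (V k) (g k)" for k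
    unfolding subordinate_def V_def using gc gbnd n by (auto simp: g_def field_simps)
  have up: "\<Lambda> (g k) \<le> measure riesz_measure (V k)" for k
    using open_mass_upper[OF Vg, of k] unfolding emeasure_riesz_measure_open[OF V, symmetric] emeasure_eq_measure
    by (simp add: ennreal_le_iff)
  have low: "measure riesz_measure (V (Suc k)) \<le> integral\<^sup>L riesz_measure (g k)" for k
  proof -
    have "measure riesz_measure (V (Suc k)) = integral\<^sup>L riesz_measure (indicator (V (Suc k)))"
      using openin_sets_riesz_measure[OF V[of "Suc k"]] by (simp add: Int_absorb1 sets.sets_into_space)
    also have "\<dots> \<le> integral\<^sup>L riesz_measure (g k)"
      using gint openin_sets_riesz_measure[OF V[of "Suc k"]] gbnd n
      by (intro integral_mono) (auto simp: indicator_def V_def g_def field_simps emeasure_eq_measure)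
    finally show ?thesis .
  qed
  have "real n * \<Lambda> h = \<Lambda> (\<lambda>x. \<Sum>k<n. g k x)"
    unfolding scale[OF h, symmetric]
    by (intro antisym mono continuous_map_sum continuous_map_real_mult_left h gc)
       (use sumg Z_subset in auto)
  also have "\<dots> = (\<Sum>k<n. \<Lambda> (g k))" by (intro sum gc) auto
  also have "\<dots> \<le> (\<Sum>k<n. measure riesz_measure (V k))" by (intro sum_mono up)
  also have "\<dots> \<le> (\<Sum>k<Suc n. measure riesz_measure (V k))" by simp
  also have "\<dots> = measure riesz_measure (V 0) + (\<Sum>k<n. measure riesz_measure (V (Suc k)))"
    by (rule sum.lessThan_Suc_shift)
  also have "\<dots> \<le> 1 + (\<Sum>k<n. integral\<^sup>L riesz_measure (g k))"
    by (intro add_mono sum_mono low) auto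
  also have "(\<Sum>k<n. integral\<^sup>L riesz_measure (g k)) = integral\<^sup>L riesz_measure (\<lambda>x. \<Sum>k<n. g k x)"
    using gint by (intro Bochner_Integration.integral_sum[symmetric]) auto
  also have "\<dots> = integral\<^sup>L riesz_measure (\<lambda>x. real n * h x)"
    by (rule Bochner_Integration.integral_cong) (auto simp: space_riesz_measure sumg)
  also have "\<dots> = real n * integral\<^sup>L riesz_measure h" by simp
  finally have "\<Lambda> h \<le> 1 / real n + integral\<^sup>L riesz_measure h" using n by (simp add: field_simps)
  then show "\<Lambda> h \<le> integral\<^sup>L riesz_measure h + e" using n by simp
qed

text \<open>The inequality for \<open>h\<close> and for \<open>-h\<close> gives equality. An affine
  change moves a bounded function into the unit interval; the \<open>+ 1\<close> in \<open>c\<close>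
  keeps the scaling factor positive even if the bound is 0.\<close>

theorem integral_riesz_measure:
  assumes h: "continuous_map X euclideanreal h" and B: "\<And>x. x \<in> topspace X \<Longrightarrow> \<bar>h x\<bar> \<le> B"
  shows "integral\<^sup>L riesz_measure h = \<Lambda> h"
proof -
  interpret prob_space riesz_measure by (rule prob_space_riesz_measure)
  have le: "\<Lambda> h \<le> integral\<^sup>L riesz_measure h"
    if h: "continuous_map X euclideanreal h" and B: "\<And>x. x \<in> topspace X \<Longrightarrow> \<bar>h x\<bar> \<le> B" for h
  proof -
    define c where "c = 2 * \<bar>B\<bar> + 1"
    have c: "c > 0" by (simp add: c_def)
    have mc: "continuous_map X euclideanreal (\<lambda>x. (1 / c) * (h x + \<bar>B\<bar>))"
      by (intro continuous_map_real_mult_left continuous_map_add h) auto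
    have "\<Lambda> (\<lambda>x. (1 / c) * (h x + \<bar>B\<bar>)) \<le> integral\<^sup>L riesz_measure (\<lambda>x. (1 / c) * (h x + \<bar>B\<bar>))"
    proof (rule functional_le_integral[OF mc])
      fix x assume "x \<in> topspace X"
      from B[OF this] have "0 \<le> h x + \<bar>B\<bar>" "h x + \<bar>B\<bar> \<le> c" unfolding c_def by linarith+
      then show "0 \<le> 1 / c * (h x + \<bar>B\<bar>) \<and> 1 / c * (h x + \<bar>B\<bar>) \<le> 1" using c by simp
    qed
    also have "\<dots> = (1 / c) * (integral\<^sup>L riesz_measure h + \<bar>B\<bar>)"
      using integrable_riesz_measure[OF h B] by (simp add: prob_space)
    also have "\<Lambda> (\<lambda>x. (1 / c) * (h x + \<bar>B\<bar>)) = (1 / c) * (\<Lambda> h + \<bar>B\<bar>)"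
      using h by (subst scale) (auto simp: add const intro: continuous_map_add)
    finally show ?thesis using c by (simp add: divide_le_cancel)
  qed
  show ?thesis
  proof (rule antisym)
    have "\<Lambda> (\<lambda>x. (-1) * h x) \<le> integral\<^sup>L riesz_measure (\<lambda>x. (-1) * h x)"
      by (rule le) (use h B in \<open>auto intro: continuous_map_real_mult_left\<close>)
    then show "integral\<^sup>L riesz_measure h \<le> \<Lambda> h" using scale[OF h, of "-1"] by simp
  qed (rule le[OF h B])
qed

end

section \<open>Ultrametric seminorms on polynomials\<close>

locale nonarch_field =
  fixes N :: "'a::alg_closed_field \<Rightarrow> real"
  assumes nonarch: "nonarch_norm N"
begin

lemma norm_nonneg [simp]: "0 \<le> N x"
  and norm_eq_0_iff [simp]: "N x = 0 \<longleftrightarrow> x = 0"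
  and norm_mult: "N (x * y) = N x * N y"
  and norm_add_le: "N (x + y) \<le> max (N x) (N y)"
  using nonarch by (auto simp: nonarch_norm_def)

lemma norm_zero [simp]: "N 0 = 0"
  by (rule norm_eq_0_iff[THEN iffD2, OF refl])

lemma norm_one [simp]: "N 1 = 1"
  by (rule nonarch_norm_one[OF nonarch])

lemma norm_minus [simp]: "N (- x) = N x"
  by (rule nonarch_norm_minus[OF nonarch])

lemma norm_pos_iff [simp]: "0 < N x \<longleftrightarrow> x \<noteq> 0"
  using norm_nonneg[of x] norm_eq_0_iff[of x] by linarith

lemma norm_power: "N (x ^ n) = N x ^ n"
  by (induction n) (auto simp: norm_mult)

lemma norm_diff_le: "N (x - y) \<le> max (N x) (N y)"
  using norm_add_le[of x "- y"] by simp

text \<open>The multiset of the factorization is identified with \<open>proots p\<close>, which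
  makes multiplicities available as counts. For \<open>p = 0\<close> the leading coefficient is 0
  and \<open>proots p\<close> is empty.\<close>

lemma
  fixes p :: "'a poly"
  shows poly_splits: "p = smult (lead_coeff p) (\<Prod>x\<in>#proots p. [:- x, 1:])"
    and size_proots: "size (proots p) = degree p"
proof -
  have "p = smult (lead_coeff p) (\<Prod>x\<in>#proots p. [:- x, 1:]) \<and> size (proots p) = degree p"
  proof (cases "p = 0")
    case False
    obtain A where A: "size A = degree p \<and> p = smult (lead_coeff p) (\<Prod>x\<in>#A. [:- x, 1:])"
      using alg_closed_imp_factorization[OF False] ..
    have "proots p = proots (\<Prod>x\<in>#A. [:- x, 1:])"
      using False by (subst A[THEN conjunct2]) simp
    also have "\<dots> = A"
    proof (induction A)
      case (add x A)
      have "(\<Prod>x\<in>#A. [:- x, 1:]) \<noteq> 0" by (auto simp: prod_mset_zero_iff)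
      then show ?case
        using add proots_mult[of "[:- x, 1:]" "\<Prod>x\<in>#A. [:- x, 1:]"] by (simp del: mult_pCons_left)
    qed simp
    finally show ?thesis using A by simp
  qed simp
  then show "p = smult (lead_coeff p) (\<Prod>x\<in>#proots p. [:- x, 1:])" "size (proots p) = degree p"
    by blast+
qed

text \<open>\<open>berkovich_seminorm\<close> asks for the triangle inequality only. Closed points,
  disc norms and their pullbacks under polynomials satisfy the stronger inequality directly, so the
  estimates are made inside this closed set of seminorms.\<close>

definition ultrametric_seminorm :: "('a poly \<Rightarrow> real) \<Rightarrow> bool" where
  "ultrametric_seminorm T \<longleftrightarrow> (\<forall>p. 0 \<le> T p) \<and> (\<forall>p q. T (p * q) = T p * T q) \<and>
     (\<forall>p q. T (p + q) \<le> max (T p) (T q)) \<and> (\<forall>c. T [:c:] = N c)"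

lemma ultrametric_seminormD:
  assumes "ultrametric_seminorm T"
  shows "0 \<le> T p" "T (p * q) = T p * T q" "T (p + q) \<le> max (T p) (T q)" "T [:c:] = N c"
    "T 1 = 1" "T (smult c p) = N c * T p" "T (- p) = T p" "T (p - q) \<le> max (T p) (T q)"
proof -
  show *: "0 \<le> T p" "T (p * q) = T p * T q" "T (p + q) \<le> max (T p) (T q)" "T [:c:] = N c" for p q c
    using assms by (auto simp: ultrametric_seminorm_def)
  show "T 1 = 1" using *(4)[of 1] by (simp add: one_pCons)
  show **: "T (smult c p) = N c * T p" for c p
    using *(2)[of "[:c:]" p] *(4)[of c] by simp
  show m: "T (- p) = T p" for p using **[of "-1" p] by simp
  show "T (p - q) \<le> max (T p) (T q)" using *(3)[of p "- q"] m[of q] by simp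
qed

lemma ultrametric_seminorm_closed_point: "ultrametric_seminorm (closed_point N x)"
  by (auto simp: ultrametric_seminorm_def closed_point_def norm_mult norm_add_le)

lemma ultrametric_seminorm_pcompose:
  assumes "ultrametric_seminorm T"
  shows "ultrametric_seminorm (\<lambda>p. T (p \<circ>\<^sub>p q))"
  using assms by (auto simp: ultrametric_seminorm_def pcompose_mult pcompose_add pcompose_const)

text \<open>Every polynomial splits, so the values on linear polynomials determine
  everything.\<close>

lemma ultrametric_seminorm_prod_roots:
  assumes T: "ultrametric_seminorm T"
  shows "T p = N (lead_coeff p) * (\<Prod>y\<in>#proots p. T [:- y, 1:])"
proof -
  have *: "T (\<Prod>x\<in>#A. [:- x, 1:]) = (\<Prod>x\<in>#A. T [:- x, 1:])" for A
    by (induction A) (simp_all add: ultrametric_seminormD[OF T] del: mult_pCons_left)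
  have "T p = T (smult (lead_coeff p) (\<Prod>x\<in>#proots p. [:- x, 1:]))"
    by (subst poly_splits) simp
  also have "\<dots> = N (lead_coeff p) * (\<Prod>y\<in>#proots p. T [:- y, 1:])"
    by (simp add: ultrametric_seminormD[OF T] *)
  finally show ?thesis .
qed

text \<open>The strict case of the ultrametric inequality: \<open>p\<close> is the sum of
  \<open>p - [:y:]\<close> and a constant too small to account for its norm.\<close>

lemma ultrametric_seminorm_far:
  assumes T: "ultrametric_seminorm T" and "N y < T p"
  shows "T (p - [:y:]) = T p"
proof (rule antisym)
  note D = ultrametric_seminormD[OF T]
  show "T (p - [:y:]) \<le> T p" using D(8)[of p "[:y:]"] D(4)[of y] assms by simp
  have "T p \<le> max (T (p - [:y:])) (N y)" using D(3)[of "p - [:y:]" "[:y:]"] D(4)[of y] by simp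
  then show "T p \<le> T (p - [:y:])" using assms by simp
qed

section \<open>Gauss norms and disc norms\<close>

definition gauss_norm :: "real \<Rightarrow> 'a poly \<Rightarrow> real" where
  "gauss_norm r p = (MAX i\<in>{..degree p}. N (coeff p i) * r ^ i)"

context
  fixes r :: real
  assumes r: "0 < r"
begin

lemma gauss_norm_upper: "N (coeff p i) * r ^ i \<le> gauss_norm r p"
proof (cases "i \<le> degree p")
  case True
  then show ?thesis unfolding gauss_norm_def by (intro Max_ge) auto
next
  case False
  have "0 \<le> N (coeff p 0) * r ^ 0" by simp
  also have "\<dots> \<le> gauss_norm r p" unfolding gauss_norm_def by (intro Max_ge imageI) auto
  finally show ?thesis using False by (simp add: coeff_eq_0)
qed

lemma gauss_norm_attained: "\<exists>i. gauss_norm r p = N (coeff p i) * r ^ i"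
proof -
  have "gauss_norm r p \<in> (\<lambda>i. N (coeff p i) * r ^ i) ` {..degree p}"
    unfolding gauss_norm_def by (rule Max_in) auto
  then show ?thesis by auto
qed

lemma gauss_norm_leI: "(\<And>i. N (coeff p i) * r ^ i \<le> c) \<Longrightarrow> gauss_norm r p \<le> c"
  using gauss_norm_attained[of p] by metis

lemma gauss_norm_nonneg: "0 \<le> gauss_norm r p"
  using order_trans[OF norm_nonneg gauss_norm_upper[of p 0, simplified]] .

lemma gauss_norm_add: "gauss_norm r (p + q) \<le> max (gauss_norm r p) (gauss_norm r q)"
proof (rule gauss_norm_leI)
  fix i
  have "N (coeff (p + q) i) * r ^ i \<le> max (N (coeff p i)) (N (coeff q i)) * r ^ i"
    using r by (intro mult_right_mono) (auto simp: norm_add_le)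
  also have "\<dots> = max (N (coeff p i) * r ^ i) (N (coeff q i) * r ^ i)"
    using r by (simp add: max_mult_distrib_right)
  also have "\<dots> \<le> max (gauss_norm r p) (gauss_norm r q)"
    using gauss_norm_upper[of p i] gauss_norm_upper[of q i] by linarith
  finally show "N (coeff (p + q) i) * r ^ i \<le> max (gauss_norm r p) (gauss_norm r q)" .
qed

lemma gauss_norm_const: "gauss_norm r [:c:] = N c"
  by (simp add: gauss_norm_def)

lemma gauss_norm_smult: "gauss_norm r (smult c p) = N c * gauss_norm r p"
proof (rule antisym)
  show "gauss_norm r (smult c p) \<le> N c * gauss_norm r p"
    by (rule gauss_norm_leI) (simp add: norm_mult mult.assoc mult_left_mono gauss_norm_upper)
  obtain i where "gauss_norm r p = N (coeff p i) * r ^ i" using gauss_norm_attained by blast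
  then show "N c * gauss_norm r p \<le> gauss_norm r (smult c p)"
    using gauss_norm_upper[of "smult c p" i] by (simp add: norm_mult mult.assoc)
qed

lemma gauss_norm_shift: "gauss_norm r (pCons 0 p) = r * gauss_norm r p"
proof (rule antisym)
  show "gauss_norm r (pCons 0 p) \<le> r * gauss_norm r p"
  proof (rule gauss_norm_leI)
    fix i
    show "N (coeff (pCons 0 p) i) * r ^ i \<le> r * gauss_norm r p"
      using r gauss_norm_nonneg[of p] gauss_norm_upper[of p "i - 1"]
      by (cases i) (auto simp: mult.left_commute)
  qed
  obtain i where "gauss_norm r p = N (coeff p i) * r ^ i" using gauss_norm_attained by blast
  then show "r * gauss_norm r p \<le> gauss_norm r (pCons 0 p)"
    using gauss_norm_upper[of "pCons 0 p" "Suc i"] by (simp add: mult_ac)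
qed

text \<open>When \<open>N y = r\<close> the two summands may cancel in norm; the last index attaining the
  maximum still survives.\<close>

lemma gauss_norm_mult_linear: "gauss_norm r (p * [:- y, 1:]) = gauss_norm r p * max (N y) r"
proof -
  have eq: "p * [:- y, 1:] = pCons 0 p + smult (- y) p" by simp
  have coeff: "coeff (p * [:- y, 1:]) (Suc i) = coeff p i - y * coeff p (Suc i)" for i
    by (simp add: eq)
  have up: "gauss_norm r (p * [:- y, 1:]) \<le> gauss_norm r p * max (N y) r"
  proof -
    have "r * gauss_norm r p \<le> gauss_norm r p * max (N y) r" "N y * gauss_norm r p \<le> gauss_norm r p * max (N y) r"
      unfolding mult.commute[of _ "gauss_norm r p"] by (intro mult_left_mono gauss_norm_nonneg; simp)+
    then show ?thesis
      using gauss_norm_add[of "pCons 0 p" "smult (- y) p"]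
      unfolding eq gauss_norm_shift gauss_norm_smult norm_minus by linarith
  qed
  moreover have "gauss_norm r p * max (N y) r \<le> gauss_norm r (p * [:- y, 1:])"
  proof (cases "r < N y")
    case True
    \<comment> \<open>\<open>smult y p\<close> is the difference of \<open>pCons 0 p\<close> and the
      product, and for nonzero \<open>p\<close> the norm of \<open>pCons 0 p\<close> is too
      small.\<close>
    have "gauss_norm r p * N y = gauss_norm r (smult y p)" by (simp add: gauss_norm_smult)
    also have "smult y p = pCons 0 p - p * [:- y, 1:]" by simp
    also have "gauss_norm r \<dots> \<le> max (gauss_norm r (pCons 0 p)) (gauss_norm r (p * [:- y, 1:]))"
      using gauss_norm_add[of "pCons 0 p" "smult (-1) (p * [:- y, 1:])"]
      unfolding gauss_norm_smult by (simp del: mult_pCons_right)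
    finally have *: "gauss_norm r p * N y \<le> max (r * gauss_norm r p) (gauss_norm r (p * [:- y, 1:]))"
      by (simp add: gauss_norm_shift)
    show ?thesis
    proof (cases "gauss_norm r p = 0")
      case True
      then show ?thesis using gauss_norm_nonneg by simp
    next
      case False
      with gauss_norm_nonneg[of p] have "r * gauss_norm r p < gauss_norm r p * N y"
        using True by simp
      with * True show ?thesis by simp
    qed
  next
    case False
    show ?thesis
    proof (cases "p = 0")
      case True
      then have "gauss_norm r p = 0" using gauss_norm_const[of 0] by simp
      then show ?thesis using gauss_norm_nonneg by simp
    next
      case p: False
      let ?I = "{i. gauss_norm r p = N (coeff p i) * r ^ i}"
      have pos: "0 < gauss_norm r p"
        using gauss_norm_upper[of p "degree p"] p r
        by (smt (verit) leading_coeff_0_iff mult_pos_pos norm_pos_iff zero_less_power)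
      then have "?I \<subseteq> {..degree p}" by (auto intro: le_degree)
      then have fin: "finite ?I" by (rule finite_subset) simp
      define i where "i = Max ?I"
      have "i \<in> ?I" unfolding i_def using fin gauss_norm_attained[of p] by (intro Max_in) auto
      then have i: "gauss_norm r p = N (coeff p i) * r ^ i" by simp
      have "Suc i \<notin> ?I" using Max_ge[OF fin, of "Suc i"] unfolding i_def by auto
      then have "N (coeff p (Suc i)) * r ^ Suc i < gauss_norm r p"
        using gauss_norm_upper[of p "Suc i"] by simp
      then have "r * N (coeff p (Suc i)) < N (coeff p i)" using r i by (simp add: mult_ac)
      moreover have "N y * N (coeff p (Suc i)) \<le> r * N (coeff p (Suc i))"
        using False by (intro mult_right_mono) auto
      ultimately have "N (y * coeff p (Suc i)) < N (coeff p i)" by (simp add: norm_mult)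
      moreover have "N (coeff p i) \<le> max (N (coeff p i - y * coeff p (Suc i))) (N (y * coeff p (Suc i)))"
        using norm_add_le[of "coeff p i - y * coeff p (Suc i)" "y * coeff p (Suc i)"] by simp
      ultimately have "N (coeff p i) \<le> N (coeff (p * [:- y, 1:]) (Suc i))"
        by (simp add: coeff del: mult_pCons_right)
      then have "N (coeff p i) * r ^ Suc i \<le> N (coeff (p * [:- y, 1:]) (Suc i)) * r ^ Suc i"
        using r by (intro mult_right_mono) auto
      also have "\<dots> \<le> gauss_norm r (p * [:- y, 1:])" by (rule gauss_norm_upper)
      finally show ?thesis using i False by (simp add: mult_ac del: mult_pCons_right)
    qed
  qed
  ultimately show ?thesis by (rule antisym)
qed

end

text \<open>Translation moves the centre \<open>a\<close> to 0; this is the point of the Berkovich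
  line that belongs to the disc of radius \<open>r\<close> around \<open>a\<close>.\<close>

definition disc_norm :: "'a \<Rightarrow> real \<Rightarrow> 'a poly \<Rightarrow> real" where
  "disc_norm a r p = gauss_norm r (p \<circ>\<^sub>p [:a, 1:])"

text \<open>Multiplicativity is needed for linear factors only; in general it is then read off from
  the roots. The logarithm of the product is a sum over the roots, which is how disc norms enter the
  integrals.\<close>

lemma disc_norm_prod_roots:
  assumes r: "0 < r"
  shows "disc_norm a r p = N (lead_coeff p) * (\<Prod>y\<in>#proots p. max (N (y - a)) r)"
proof -
  have *: "disc_norm a r (\<Prod>x\<in>#A. [:- x, 1:]) = (\<Prod>y\<in>#A. max (N (y - a)) r)" for A
  proof (induction A)
    case empty
    show ?case using gauss_norm_const[OF r, of 1] by (simp add: disc_norm_def one_pCons pcompose_const)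
  next
    case (add x A)
    have "disc_norm a r (\<Prod>x\<in>#add_mset x A. [:- x, 1:]) =
        gauss_norm r (((\<Prod>x\<in>#A. [:- x, 1:]) \<circ>\<^sub>p [:a, 1:]) * [:- (x - a), 1:])"
    proof -
      have "[:- x, 1:] \<circ>\<^sub>p [:a, 1:] = [:- (x - a), 1:]" by (simp add: pcompose_pCons)
      then show ?thesis
        by (simp add: disc_norm_def pcompose_mult mult.commute del: mult_pCons_left mult_pCons_right pcompose_pCons)
    qed
    also have "\<dots> = disc_norm a r (\<Prod>x\<in>#A. [:- x, 1:]) * max (N (x - a)) r"
      unfolding gauss_norm_mult_linear[OF r] disc_norm_def ..
    finally show ?case using add by (simp add: mult.commute)
  qed
  have "disc_norm a r p = disc_norm a r (smult (lead_coeff p) (\<Prod>x\<in>#proots p. [:- x, 1:]))"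
    by (subst poly_splits) simp
  also have "\<dots> = N (lead_coeff p) * disc_norm a r (\<Prod>x\<in>#proots p. [:- x, 1:])"
    by (simp add: disc_norm_def pcompose_smult gauss_norm_smult[OF r])
  finally show ?thesis by (simp add: *)
qed

lemma ultrametric_seminorm_disc_norm:
  assumes r: "0 < r"
  shows "ultrametric_seminorm (disc_norm a r)"
  unfolding ultrametric_seminorm_def
proof (intro conjI allI)
  fix p q c
  show "0 \<le> disc_norm a r p" by (simp add: disc_norm_def gauss_norm_nonneg[OF r])
  show "disc_norm a r (p + q) \<le> max (disc_norm a r p) (disc_norm a r q)"
    by (simp add: disc_norm_def gauss_norm_add[OF r] pcompose_add)
  show "disc_norm a r [:c:] = N c" by (simp add: disc_norm_def gauss_norm_const[OF r] pcompose_const)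
  show "disc_norm a r (p * q) = disc_norm a r p * disc_norm a r q"
  proof (cases "p = 0 \<or> q = 0")
    case True
    then show ?thesis by (auto simp: disc_norm_prod_roots[OF r])
  next
    case False
    then show ?thesis
      by (simp add: disc_norm_prod_roots[OF r] proots_mult lead_coeff_mult norm_mult)
  qed
qed

lemma disc_norm_linear:
  assumes "0 < r"
  shows "disc_norm a r [:- y, 1:] = max (N (y - a)) r"
  by (simp add: disc_norm_prod_roots[OF assms])

end

section \<open>Polynomial dynamics over a non-Archimedean field\<close>

lemma poly_iterate_Suc: "poly_iterate f (Suc n) = f \<circ>\<^sub>p poly_iterate f n"
  by (simp add: poly_iterate_def)

lemma poly_iterate_0: "poly_iterate f 0 = [:0, 1:]"
  by (simp add: poly_iterate_def)

lemma prod_mset_partition_eq: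
  fixes g :: "'b \<Rightarrow> real"
  shows "(\<Prod>w\<in>#M. g w) = g y ^ count M y * (\<Prod>w\<in>#filter_mset (\<lambda>w. w \<noteq> y) M. g w)"
proof -
  have "M = filter_mset (\<lambda>w. w = y) M + filter_mset (\<lambda>w. w \<noteq> y) M"
    by (rule multiset_partition)
  then have "(\<Prod>w\<in>#M. g w) = (\<Prod>w\<in>#filter_mset (\<lambda>w. w = y) M. g w) * (\<Prod>w\<in>#filter_mset (\<lambda>w. w \<noteq> y) M. g w)"
    by (metis image_mset_union prod_mset_Un)
  also have "filter_mset (\<lambda>w. w = y) M = replicate_mset (count M y) y"
    by (simp add: filter_eq_replicate_mset)
  finally show ?thesis by simp
qed

lemma prod_mset_ge_power:
  fixes g :: "'b \<Rightarrow> real"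
  assumes "\<And>w. w \<in># M \<Longrightarrow> c \<le> g w" "0 \<le> c"
  shows "c ^ size M \<le> (\<Prod>w\<in>#M. g w)"
  using assms
proof (induction M)
  case (add x M)
  then show ?case by (auto intro!: mult_mono intro: order_trans[of 0 c])
qed simp

lemma prod_mset_eq_power:
  fixes g :: "'b \<Rightarrow> real"
  assumes "\<And>w. w \<in># M \<Longrightarrow> g w = c"
  shows "(\<Prod>w\<in>#M. g w) = c ^ size M"
  using assms by (induction M) auto

text \<open>The derivative is a nonzero multiple of \<open>(z - y)^(d - 1)\<close>, so it determines
  \<open>y\<close>. Characteristic zero enters here: in characteristic \<open>p\<close> the map
  \<open>z^p\<close> is totally ramified at every point.\<close>

lemma totally_ramified_point_unique:
  fixes c :: "'a::field_char_0"
  assumes eq: "smult c ([:- y, 1:] ^ d) + [:x:] = smult c' ([:- y', 1:] ^ d) + [:x':]"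
    and c: "c \<noteq> 0" "c' \<noteq> 0" and d: "d > 1"
  shows "y = y'"
proof -
  have "pderiv (smult c ([:- y, 1:] ^ d) + [:x:]) = smult (c * of_nat d) ([:- y, 1:] ^ (d - 1))" for c y x :: 'a
    using d by (cases d) (simp_all add: pderiv_add pderiv_smult pderiv_power_Suc pderiv_pCons ac_simps del: power_Suc)
  with eq have "smult (c * of_nat d) ([:- y, 1:] ^ (d - 1)) = smult (c' * of_nat d) ([:- y', 1:] ^ (d - 1))"
    by metis
  then have "poly (smult (c * of_nat d) ([:- y, 1:] ^ (d - 1))) y = poly (smult (c' * of_nat d) ([:- y', 1:] ^ (d - 1))) y"
    by simp
  then show ?thesis using c d by (simp add: power_0_left)
qed

locale nonarch_dynamics = nonarch_field N
  for N :: "'a::{alg_closed_field, field_char_0} \<Rightarrow> real" +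
  fixes f :: "'a poly"
  assumes degree_gt_1: "degree f > 1"
begin

abbreviation d :: nat where "d \<equiv> degree f"
abbreviation F :: "nat \<Rightarrow> 'a poly" where "F \<equiv> poly_iterate f"

text \<open>Total invariance: \<open>x\<close> is its own only preimage, with multiplicity
  \<open>d\<close>.\<close>

definition exceptional :: "'a \<Rightarrow> bool" where
  "exceptional x \<longleftrightarrow> f - [:x:] = smult (lead_coeff f) ([:- x, 1:] ^ d)"

lemma lead_coeff_nz: "lead_coeff f \<noteq> 0"
  using degree_gt_1 by auto

lemma degree_iterate_pos: "0 < degree (F n)"
  using degree_gt_1 by (simp add: degree_poly_iterate)

lemma diff_const:
  fixes p :: "'a poly"
  assumes "0 < degree p"
  shows "degree (p - [:x:]) = degree p" "lead_coeff (p - [:x:]) = lead_coeff p" "p - [:x:] \<noteq> 0"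
proof -
  show *: "degree (p - [:x:]) = degree p" for x
  proof -
    have "p - [:x:] = p + [:- x:]" by simp
    also have "degree \<dots> = degree p" using assms by (intro degree_add_eq_left) simp
    finally show ?thesis .
  qed
  show "lead_coeff (p - [:x:]) = lead_coeff p"
    using assms unfolding * by (cases "degree p") auto
  show "p - [:x:] \<noteq> 0" using assms *[of x] by auto
qed

lemma d_pos: "0 < d"
  using degree_gt_1 by simp

lemmas f_diff_const = diff_const[OF d_pos]
lemmas F_diff_const = diff_const[OF degree_iterate_pos]

lemma poly_f_preimage_iff: "y \<in># proots (f - [:x:]) \<longleftrightarrow> poly f y = x"
  using set_count_proots[OF f_diff_const(3)] by simp

lemma iterate_preimage_iff: "y \<in># proots (F n - [:x:]) \<longleftrightarrow> (poly f ^^ n) y = x"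
  using set_count_proots[OF F_diff_const(3)] by (simp add: poly_poly_iterate)

lemma order_le_degree: "order y (f - [:x:]) \<le> d"
  using order_degree[OF f_diff_const(3)] by (simp only: f_diff_const(1))

section \<open>Total ramification\<close>

lemma totally_ramified:
  assumes "order y (f - [:x:]) = d"
  shows "f - [:x:] = smult (lead_coeff f) ([:- y, 1:] ^ d)"
proof -
  have "[:- y, 1:] ^ d dvd f - [:x:]" using order_1[of y "f - [:x:]"] assms by simp
  then obtain q where q: "f - [:x:] = [:- y, 1:] ^ d * q" by (rule dvdE)
  have nz: "q \<noteq> 0" using q f_diff_const(3)[of x] by auto
  have "degree (f - [:x:]) = d + degree q"
    unfolding q using nz by (subst degree_mult_eq) (auto simp: degree_linear_power)
  then have "degree q = 0" using f_diff_const(1)[of x] by simp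
  then obtain c where c: "q = [:c:]" by (rule degree_eq_zeroE)
  have "lead_coeff f = lead_coeff ([:- y, 1:] ^ d * q)"
    using f_diff_const(2)[of x] unfolding q[symmetric] by simp
  then have "lead_coeff f = c" by (simp add: lead_coeff_mult lead_coeff_power c)
  then show ?thesis using q c by simp
qed

lemma totally_ramified_unique:
  assumes "order y (f - [:x:]) = d" "order y' (f - [:x':]) = d"
  shows "y = y'"
proof (rule totally_ramified_point_unique)
  show "smult (lead_coeff f) ([:- y, 1:] ^ d) + [:x:] = smult (lead_coeff f) ([:- y', 1:] ^ d) + [:x':]"
    using totally_ramified[OF assms(1)] totally_ramified[OF assms(2)] by (metis diff_add_cancel)
qed (use lead_coeff_nz degree_gt_1 in auto)

lemma exceptional_iff_order: "exceptional x \<longleftrightarrow> order x (f - [:x:]) = d"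
proof
  assume "exceptional x"
  then show "order x (f - [:x:]) = d"
    using lead_coeff_nz order_power_n_n[of x d] by (simp add: exceptional_def order_smult)
next
  assume "order x (f - [:x:]) = d"
  from totally_ramified[OF this] show "exceptional x" by (simp add: exceptional_def)
qed

lemma exceptional_unique: "exceptional x \<Longrightarrow> exceptional x' \<Longrightarrow> x = x'"
  using totally_ramified_unique by (simp add: exceptional_iff_order)

lemma exceptional_value: "exceptional x \<Longrightarrow> poly f x = x"
  using poly_f_preimage_iff[of x x] order_root[of "f - [:x:]" x] d_pos
  by (simp add: exceptional_iff_order)

lemma not_exceptional_preimage: "\<not> exceptional x \<Longrightarrow> poly f y = x \<Longrightarrow> \<not> exceptional y"
  using exceptional_value by auto

text \<open>Both \<open>y\<close> and its preimage \<open>y'\<close> are totally ramified, hence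
  equal. So \<open>y\<close> is fixed and coincides with \<open>x\<close>.\<close>

lemma ramified_twice_imp_exceptional:
  assumes "poly f y = x" "order y (f - [:x:]) = d" "poly f y' = y" "order y' (f - [:y:]) = d"
  shows "exceptional x"
proof -
  have "y = y'" using totally_ramified_unique assms by blast
  then show ?thesis using assms by (auto simp: exceptional_iff_order)
qed

lemma exists_nonexceptional: "\<exists>x. \<not> exceptional x"
  using exceptional_unique[of 0 1] by auto

text \<open>If \<open>a^(d - 1)\<close> is the leading coefficient, conjugation by multiplication
  with \<open>a\<close> makes \<open>f\<close> monic, and \<open>\<kappa>\<close> is
  \<open>ln (N a)\<close>. The leading coefficient of \<open>F n\<close> is
  \<open>a^(d^n - 1)\<close>.\<close>

definition \<kappa> :: real where "\<kappa> = ln (N (lead_coeff f)) / (real d - 1)"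

lemma ln_lead_coeff: "ln (N (lead_coeff f)) = (real d - 1) * \<kappa>"
  using degree_gt_1 by (simp add: \<kappa>_def)

lemma lead_coeff_iterate_nz: "lead_coeff (F n) \<noteq> 0"
  using degree_iterate_pos[of n] by auto

lemma ln_lead_coeff_iterate: "ln (N (lead_coeff (F n))) = \<kappa> * (real d ^ n - 1)"
proof (induction n)
  case (Suc n)
  have "lead_coeff (F (Suc n)) = lead_coeff f * lead_coeff (F n) ^ d"
    unfolding poly_iterate_Suc by (rule lead_coeff_comp[OF degree_iterate_pos])
  then have "ln (N (lead_coeff (F (Suc n)))) = ln (N (lead_coeff f)) + real d * ln (N (lead_coeff (F n)))"
    using lead_coeff_nz lead_coeff_iterate_nz[of n] by (simp add: norm_mult norm_power ln_mult ln_realpow)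
  then show ?case using Suc by (simp add: ln_lead_coeff algebra_simps)
qed (simp add: poly_iterate_0)

lemma d_power_at_top: "filterlim (\<lambda>n. real d ^ n) at_top sequentially"
  using degree_gt_1
  by (intro filterlim_at_infinity_imp_filterlim_at_top filterlim_realpow_sequentially_gt1 always_eventually) auto

lemma eventually_le_d_power: "0 < c \<Longrightarrow> \<forall>\<^sub>F n in sequentially. M \<le> c * real d ^ n"
proof -
  assume c: "0 < c"
  have "\<forall>\<^sub>F n in sequentially. M / c \<le> real d ^ n"
    using d_power_at_top by (simp add: filterlim_at_top)
  then show ?thesis by eventually_elim (use c in \<open>simp add: field_simps\<close>)
qed

lemma const_div_d_power: "(\<lambda>n. M / real d ^ n) \<longlonglongrightarrow> 0"
  by (rule tendsto_divide_0[OF tendsto_const filterlim_at_top_imp_at_infinity[OF d_power_at_top]])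

section \<open>Escape to infinity\<close>

lemma sum_norm_nonneg: "0 \<le> (\<Sum>y\<in>#A. N y)"
  by (induction A) auto

text \<open>One number that dominates 1, the inverse of the leading coefficient and every root of
  \<open>f\<close>.\<close>

definition escape_radius :: real where
  "escape_radius = 1 + 1 / N (lead_coeff f) + (\<Sum>y\<in>#proots f. N y)"

lemma escape_radius_ge_1: "1 \<le> escape_radius"
  unfolding escape_radius_def by (simp add: sum_norm_nonneg add_nonneg_nonneg)

text \<open>Stated for seminorms because it is applied both to closed points and to the pullbacks of
  \<open>D\<close> under iterates.\<close>

lemma escape:
  assumes T: "ultrametric_seminorm T" and far: "escape_radius < T [:0, 1:]"
  shows "T f = N (lead_coeff f) * T [:0, 1:] ^ d" "1 < N (lead_coeff f) * T [:0, 1:] ^ (d - 1)"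
proof -
  let ?t = "T [:0, 1:]" and ?b = "N (lead_coeff f)"
  have b: "0 < ?b" using lead_coeff_nz by simp
  have sum: "0 \<le> (\<Sum>y\<in>#proots f. N y)" by (simp add: sum_norm_nonneg)
  have "0 < 1 / ?b" using b by simp
  moreover have "1 + 1 / ?b + (\<Sum>y\<in>#proots f. N y) < ?t"
    using far by (simp only: escape_radius_def)
  ultimately have t: "1 < ?t" "1 / ?b < ?t" "(\<Sum>y\<in>#proots f. N y) < ?t"
    using sum by linarith+
  have lin: "T [:- y, 1:] = ?t" if y: "y \<in># proots f" for y
  proof -
    have "N y \<le> (\<Sum>y\<in>#proots f. N y)"
      using multi_member_split[OF y] by (auto simp: sum_norm_nonneg)
    also have "\<dots> < ?t" by (rule t(3))
    finally show ?thesis using ultrametric_seminorm_far[OF T, of y "[:0, 1:]"] by simp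
  qed
  have "(\<Prod>y\<in>#proots f. T [:- y, 1:]) = ?t ^ d"
    using prod_mset_eq_power[of "proots f" "\<lambda>y. T [:- y, 1:]"] lin by (simp add: size_proots)
  then show "T f = ?b * ?t ^ d" using ultrametric_seminorm_prod_roots[OF T, of f] by simp
  have "?t ^ 1 \<le> ?t ^ (d - 1)" using t(1) degree_gt_1 by (intro power_increasing) auto
  then have "?b * ?t \<le> ?b * ?t ^ (d - 1)" using b by simp
  moreover have "1 < ?b * ?t" using t(2) b by (simp add: field_simps)
  ultimately show "1 < ?b * ?t ^ (d - 1)" by simp
qed

lemma escape_increasing:
  assumes T: "ultrametric_seminorm T" and far: "escape_radius < T [:0, 1:]"
  shows "T [:0, 1:] < T f"
proof -
  let ?t = "T [:0, 1:]" and ?b = "N (lead_coeff f)"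
  have "0 < ?t" using far escape_radius_ge_1 by simp
  then have "?t * 1 < ?t * (?b * ?t ^ (d - 1))" using escape(2)[OF T far] by (intro mult_strict_left_mono)
  also have "\<dots> = ?b * ?t ^ d" using degree_gt_1 by (cases d) auto
  finally show ?thesis using escape(1)[OF T far] by simp
qed

text \<open>Beyond the escape radius \<open>f\<close> increases the norm, so a point farther out
  than \<open>x\<close> can never return to \<open>x\<close>. The bound is uniform in
  \<open>n\<close>.\<close>

lemma norm_preimage_le:
  assumes "(poly f ^^ n) y = x"
  shows "N y \<le> max escape_radius (N x)"
proof (rule ccontr)
  assume "\<not> ?thesis"
  then have y: "escape_radius < N y" "N x < N y" by auto
  have "N y \<le> N ((poly f ^^ n) y)"
  proof (induction n)
    case (Suc n)
    have "closed_point N ((poly f ^^ n) y) [:0, 1:] < closed_point N ((poly f ^^ n) y) f"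
      by (rule escape_increasing[OF ultrametric_seminorm_closed_point]) (use Suc y in \<open>simp add: closed_point_def\<close>)
    then show ?case using Suc by (simp add: closed_point_def)
  qed simp
  then show False using assms y by simp
qed

end

text \<open>The number \<open>r\<close> keeps \<open>D\<close> away from the closed points.\<close>

locale nonarch_dynamics_seminorm = nonarch_dynamics N f
  for N :: "'a::{alg_closed_field, field_char_0} \<Rightarrow> real" and f :: "'a poly" +
  fixes D :: "'a poly \<Rightarrow> real" and r :: real
  assumes D: "ultrametric_seminorm D" and r: "0 < r" and D_linear: "\<And>y. r \<le> D [:- y, 1:]"
begin

section \<open>Lower bounds along the orbit of a seminorm\<close>

lemma D_compose: "D (p \<circ>\<^sub>p q) = N (lead_coeff p) * (\<Prod>y\<in>#proots p. D (q - [:y:]))"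
proof -
  have "[:- y, 1:] \<circ>\<^sub>p q = q - [:y:]" for y by (simp add: pcompose_pCons)
  then show ?thesis
    using ultrametric_seminorm_prod_roots[OF ultrametric_seminorm_pcompose[OF D, of q], of p]
    by (simp only:)
qed

lemma D_iterate_ge: "N (lead_coeff (F n)) * r ^ (d ^ n) \<le> D (F n - [:y:])"
proof -
  have "r ^ size (proots (F n - [:y:])) \<le> (\<Prod>w\<in>#proots (F n - [:y:]). D [:- w, 1:])"
    using r D_linear by (intro prod_mset_ge_power) auto
  then have "N (lead_coeff (F n)) * r ^ (d ^ n)
      \<le> N (lead_coeff (F n)) * (\<Prod>w\<in>#proots (F n - [:y:]). D [:- w, 1:])"
    unfolding size_proots F_diff_const(1) degree_poly_iterate by (rule mult_left_mono) simp
  then show ?thesis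
    by (subst ultrametric_seminorm_prod_roots[OF D], subst F_diff_const(2))
qed

lemma D_iterate_pos: "0 < D (F n - [:y:])"
proof -
  have "0 < N (lead_coeff (F n)) * r ^ (d ^ n)" using r lead_coeff_iterate_nz by simp
  then show ?thesis using D_iterate_ge[of n y] by linarith
qed

text \<open>The crude bound from which the improvement starts: each of the \<open>d^n\<close> roots
  contributes at least \<open>r\<close>, and the leading coefficient is governed by
  \<open>\<kappa>\<close>.\<close>

lemma ln_D_iterate_ge: "- (\<bar>\<kappa>\<bar> + \<bar>ln r\<bar>) * real d ^ n \<le> ln (D (F n - [:y:]))"
proof -
  have "ln (N (lead_coeff (F n)) * r ^ (d ^ n)) \<le> ln (D (F n - [:y:]))"
    using D_iterate_ge[of n y] r lead_coeff_iterate_nz[of n] by (subst ln_le_cancel_iff) (auto simp: D_iterate_pos)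
  also have "ln (N (lead_coeff (F n)) * r ^ (d ^ n)) = \<kappa> * (real d ^ n - 1) + real d ^ n * ln r"
    using r lead_coeff_iterate_nz[of n] by (simp add: ln_mult ln_realpow ln_lead_coeff_iterate)
  finally have 1: "\<kappa> * (real d ^ n - 1) + real d ^ n * ln r \<le> ln (D (F n - [:y:]))" .
  have dn: "1 \<le> real d ^ n" using degree_gt_1 by simp
  have "- \<bar>\<kappa>\<bar> * (real d ^ n - 1) \<le> \<kappa> * (real d ^ n - 1)" using dn by (intro mult_right_mono) auto
  moreover have "\<bar>\<kappa>\<bar> * (real d ^ n - 1) \<le> \<bar>\<kappa>\<bar> * real d ^ n" by (intro mult_left_mono) auto
  moreover have "real d ^ n * (- \<bar>ln r\<bar>) \<le> real d ^ n * ln r" using dn by (intro mult_left_mono) auto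
  ultimately show ?thesis using 1 by (simp add: algebra_simps)
qed

text \<open>Distinct preimages of \<open>x\<close> are separated, so \<open>F n\<close> can be close to at most one of them.\<close>

lemma ln_D_step:
  "\<exists>A. \<forall>n. \<exists>y. poly f y = x \<and>
     A + real (order y (f - [:x:])) * ln (D (F n - [:y:])) \<le> ln (D (F (Suc n) - [:x:]))"
proof -
  let ?M = "proots (f - [:x:])" and ?b = "N (lead_coeff f)"
  have nz: "f - [:x:] \<noteq> 0" and lc: "lead_coeff (f - [:x:]) = lead_coeff f"
    and deg: "degree (f - [:x:]) = d" by (rule f_diff_const)+
  have sM: "size ?M = d" by (simp add: size_proots deg)
  then have ne: "set_mset ?M \<noteq> {}" using degree_gt_1 by auto
  have b: "0 < ?b" using lead_coeff_nz by simp
  \<comment> \<open>The cap at 1 makes \<open>\<delta> ^ d\<close> a lower bound for all smaller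
    powers, whatever the number of other preimages.\<close>
  have "\<exists>\<delta>. 0 < \<delta> \<and> \<delta> \<le> 1 \<and> (\<forall>y\<in>#?M. \<forall>w\<in>#?M. y \<noteq> w \<longrightarrow> \<delta> \<le> N (w - y))"
  proof -
    let ?P = "insert 1 ((\<lambda>(y, w). N (w - y)) ` {(y, w) \<in> set_mset ?M \<times> set_mset ?M. y \<noteq> w})"
    have fin: "finite ?P" by (intro finite.insertI finite_imageI) (auto intro: finite_subset[of _ "set_mset ?M \<times> set_mset ?M"])
    have "Min ?P \<in> ?P" using fin by (intro Min_in) auto
    then have "0 < Min ?P" by (auto simp del: Min_in)
    moreover have "Min ?P \<le> 1" using fin by (intro Min_le) auto
    moreover have "Min ?P \<le> N (w - y)" if "y \<in># ?M" "w \<in># ?M" "y \<noteq> w" for y w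
      using fin that by (intro Min_le) auto
    ultimately show ?thesis by blast
  qed
  then obtain \<delta> where \<delta>: "0 < \<delta>" "\<delta> \<le> 1" "\<And>y w. y \<in># ?M \<Longrightarrow> w \<in># ?M \<Longrightarrow> y \<noteq> w \<Longrightarrow> \<delta> \<le> N (w - y)" by blast
  define A where "A = ln ?b + real d * ln \<delta>"
  show ?thesis
  proof (intro exI[of _ A] allI)
    fix n
    let ?g = "\<lambda>y. D (F n - [:y:])"
    \<comment> \<open>The preimage nearest to \<open>F n\<close> varies with \<open>n\<close>, but
      within a finite set, and \<open>A\<close> is fixed beforehand.\<close>
    obtain y where y: "y \<in># ?M" "\<And>w. w \<in># ?M \<Longrightarrow> ?g y \<le> ?g w"
      using ne ex_min_if_finite[of "?g ` set_mset ?M"] by (auto simp: not_less)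
    have sep: "\<delta> \<le> ?g w" if "w \<in># ?M" "w \<noteq> y" for w
    proof -
      \<comment> \<open>\<open>F n\<close> cancels, so the distance of \<open>w\<close> and
        \<open>y\<close> is at most the larger of the two values, which is the one at
        \<open>w\<close>.\<close>
      have "[:w - y:] = (F n - [:y:]) - (F n - [:w:])" by simp
      then have "N (w - y) \<le> max (?g y) (?g w)"
        using ultrametric_seminormD(8)[OF D, of "F n - [:y:]" "F n - [:w:]"]
          ultrametric_seminormD(4)[OF D, of "w - y"] by metis
      then show ?thesis using \<delta>(3)[OF y(1) that(1)] that(2) y(2)[OF that(1)] by auto
    qed
    let ?M' = "filter_mset (\<lambda>w. w \<noteq> y) ?M"
    have "\<delta> ^ d \<le> \<delta> ^ size ?M'"
      using \<delta> sM size_filter_mset_lesseq[of "\<lambda>w. w \<noteq> y" ?M] by (intro power_decreasing) auto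
    also have "\<dots> \<le> (\<Prod>w\<in>#?M'. ?g w)" using \<delta> sep by (intro prod_mset_ge_power) auto
    finally have "?b * (?g y ^ count ?M y * \<delta> ^ d) \<le> ?b * (\<Prod>w\<in>#?M. ?g w)"
      using D_iterate_pos[of n y] b unfolding prod_mset_partition_eq[of ?g ?M y]
      by (intro mult_left_mono) auto
    also have "\<dots> = D (F (Suc n) - [:x:])"
    proof -
      have "F (Suc n) - [:x:] = (f - [:x:]) \<circ>\<^sub>p F n" by (simp add: poly_iterate_Suc pcompose_diff pcompose_const)
      then show ?thesis using D_compose[of "f - [:x:]" "F n"] lc by simp
    qed
    finally have "ln (?b * (?g y ^ count ?M y * \<delta> ^ d)) \<le> ln (D (F (Suc n) - [:x:]))"
      using b \<delta> D_iterate_pos by (subst ln_le_cancel_iff) auto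
    also have "ln (?b * (?g y ^ count ?M y * \<delta> ^ d)) = A + real (order y (f - [:x:])) * ln (?g y)"
      using b \<delta> D_iterate_pos[of n y] nz by (simp add: ln_mult ln_realpow A_def)
    finally show "\<exists>y. poly f y = x \<and> A + real (order y (f - [:x:])) * ln (?g y) \<le> ln (D (F (Suc n) - [:x:]))"
      using y(1) by (auto simp: poly_f_preimage_iff)
  qed
qed

text \<open>\<open>\<theta>\<close> is an exponential rate: eventually
  \<open>D (F n - [:x:])\<close> is at least \<open>exp (- \<theta> * d^n)\<close>. Having every
  positive rate is the lower half of convergence to 0.\<close>

definition bounded_decay :: "real \<Rightarrow> 'a \<Rightarrow> bool" where
  "bounded_decay \<theta> x \<longleftrightarrow> (\<forall>\<^sub>F n in sequentially. - \<theta> * real d ^ n \<le> ln (D (F n - [:x:])))"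

text \<open>A preimage of multiplicity \<open>e\<close> hands on its rate multiplied by
  \<open>e / d\<close>. The strict inequality leaves a multiple of \<open>d^n\<close> to absorb the
  constant \<open>A\<close>.\<close>

lemma bounded_decay_step:
  assumes "\<And>y. poly f y = x \<Longrightarrow> \<exists>\<theta>. real (order y (f - [:x:])) * \<theta> < real d * K \<and> bounded_decay \<theta> y"
  shows "bounded_decay K x"
proof -
  let ?e = "\<lambda>y. real (order y (f - [:x:]))"
  obtain A where A: "\<And>n. \<exists>y. poly f y = x \<and> A + ?e y * ln (D (F n - [:y:])) \<le> ln (D (F (Suc n) - [:x:]))"
    using ln_D_step[of x] by blast
  have "finite (set_mset (proots (f - [:x:])))" by simp
  also have "set_mset (proots (f - [:x:])) = {y. poly f y = x}" by (auto simp: poly_f_preimage_iff simp del: set_count_proots)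
  finally have fin: "finite {y. poly f y = x}" .
  have "\<forall>\<^sub>F n in sequentially. - K * real d ^ Suc n \<le> A + ?e y * ln (D (F n - [:y:]))"
    if y: "poly f y = x" for y
  proof -
    obtain \<theta> where \<theta>: "?e y * \<theta> < real d * K" "bounded_decay \<theta> y" using assms[OF y] by blast
    define c where "c = real d * K - ?e y * \<theta>"
    have c: "0 < c" using \<theta> by (simp add: c_def)
    have "\<forall>\<^sub>F n in sequentially. - A \<le> c * real d ^ n" by (rule eventually_le_d_power[OF c])
    with \<theta>(2) show ?thesis unfolding bounded_decay_def
    proof eventually_elim
      case (elim n)
      have "?e y * (- \<theta> * real d ^ n) \<le> ?e y * ln (D (F n - [:y:]))"
        using elim(1) by (intro mult_left_mono) auto
      then show ?case using elim(2) by (simp add: c_def algebra_simps)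
    qed
  qed
  \<comment> \<open>The preimage provided by \<open>A\<close> changes with \<open>n\<close>, so the
    estimate must hold at all preimages simultaneously.\<close>
  then have "\<forall>\<^sub>F n in sequentially. \<forall>y\<in>{y. poly f y = x}. - K * real d ^ Suc n \<le> A + ?e y * ln (D (F n - [:y:]))"
    using fin by (intro eventually_ball_finite) auto
  then have "\<forall>\<^sub>F n in sequentially. - K * real d ^ Suc n \<le> ln (D (F (Suc n) - [:x:]))"
  proof eventually_elim
    case (elim n)
    then show ?case using A[of n] by force
  qed
  then show ?thesis unfolding bounded_decay_def eventually_sequentially_Suc[of "\<lambda>n. - K * real d ^ n \<le> ln (D (F n - [:x:]))"] .
qed

lemma bounded_decay_mono: "bounded_decay \<theta> x \<Longrightarrow> \<theta> \<le> \<theta>' \<Longrightarrow> bounded_decay \<theta>' x"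
  unfolding bounded_decay_def
proof (erule eventually_mono)
  fix n assume "- \<theta> * real d ^ n \<le> ln (D (F n - [:x:]))" "\<theta> \<le> \<theta>'"
  moreover from \<open>\<theta> \<le> \<theta>'\<close> have "- \<theta>' * real d ^ n \<le> - \<theta> * real d ^ n" by (intro mult_right_mono) auto
  ultimately show "- \<theta>' * real d ^ n \<le> ln (D (F n - [:x:]))" by linarith
qed

text \<open>Multiplicities are now at most \<open>d - 1\<close>. The \<open>\<epsilon>\<close> pays
  for the strict inequality in \<open>bounded_decay_step\<close>.\<close>

lemma bounded_decay_contract:
  assumes "\<And>y. poly f y = x \<Longrightarrow> order y (f - [:x:]) < d"
    and "\<And>y \<epsilon>. poly f y = x \<Longrightarrow> 0 < \<epsilon> \<Longrightarrow> bounded_decay (C + \<epsilon>) y"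
    and C: "0 \<le> C" and \<epsilon>: "0 < \<epsilon>"
  shows "bounded_decay (C * ((real d - 1) / real d) + \<epsilon>) x"
proof (rule bounded_decay_step)
  fix y assume y: "poly f y = x"
  have "real (order y (f - [:x:])) * (C + \<epsilon> / 2) \<le> (real d - 1) * (C + \<epsilon> / 2)"
    using assms(1)[OF y] C \<epsilon> by (intro mult_right_mono) auto
  also have "\<dots> < real d * (C * ((real d - 1) / real d) + \<epsilon>)"
  proof -
    have "(real d - 1) * (\<epsilon> / 2) < real d * \<epsilon>" using \<epsilon> d_pos by (intro mult_strict_mono) auto
    moreover have "real d * (C * ((real d - 1) / real d) + \<epsilon>) = (real d - 1) * C + real d * \<epsilon>"
      using d_pos by (simp add: field_simps)
    ultimately show ?thesis by (simp only: distrib_left add_strict_left_mono)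
  qed
  finally show "\<exists>\<theta>. real (order y (f - [:x:])) * \<theta> < real d * (C * ((real d - 1) / real d) + \<epsilon>)
      \<and> bounded_decay \<theta> y"
    using assms(2)[OF y, of "\<epsilon> / 2"] \<epsilon> by (intro exI[of _ "C + \<epsilon> / 2"]) simp
qed

text \<open>If no preimage of \<open>x\<close> is totally ramified, one backward step gains the
  factor. Otherwise the preimage is unique, this step gains nothing, and the factor is gained one
  generation earlier, where total ramification cannot recur.\<close>

lemma bounded_decay_power:
  assumes "\<not> exceptional x" "0 < \<epsilon>"
  shows "bounded_decay ((\<bar>\<kappa>\<bar> + \<bar>ln r\<bar>) * ((real d - 1) / real d) ^ k + \<epsilon>) x"
  using assms
proof (induction k arbitrary: x \<epsilon>)
  case 0
  have "bounded_decay (\<bar>\<kappa>\<bar> + \<bar>ln r\<bar>) x"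
    unfolding bounded_decay_def using ln_D_iterate_ge by (intro always_eventually allI) simp
  then show ?case by (rule bounded_decay_mono) (use 0 in simp)
next
  case (Suc k)
  let ?q = "(real d - 1) / real d" and ?C = "\<bar>\<kappa>\<bar> + \<bar>ln r\<bar>"
  let ?K = "?C * ?q ^ k"
  have K: "0 \<le> ?K" using d_pos by (intro mult_nonneg_nonneg zero_le_power) auto
  have contract: "bounded_decay (?K * ?q + \<epsilon>) x"
    if "\<not> exceptional x" "\<And>y. poly f y = x \<Longrightarrow> order y (f - [:x:]) < d" "0 < \<epsilon>" for x \<epsilon>
    using that not_exceptional_preimage Suc.IH K by (intro bounded_decay_contract) blast+
  have "bounded_decay (?K * ?q + \<epsilon>) x"
  proof (cases "\<exists>y. poly f y = x \<and> order y (f - [:x:]) = d")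
    case False
    then show ?thesis using Suc.prems order_le_degree by (intro contract) (auto simp: le_neq_implies_less)
  next
    case True
    show ?thesis
    proof (rule bounded_decay_step)
      fix y assume y: "poly f y = x"
      have ny: "\<not> exceptional y" using not_exceptional_preimage Suc.prems y by blast
      obtain y0 where y0: "poly f y0 = x" "order y0 (f - [:x:]) = d" using True by blast
      have "y = y0"
      proof -
        have "poly (f - [:x:]) y = 0" using y by simp
        then show ?thesis using lead_coeff_nz unfolding totally_ramified[OF y0(2)] by simp
      qed
      then have "\<And>y'. poly f y' = y \<Longrightarrow> order y' (f - [:y:]) < d"
        using ramified_twice_imp_exceptional[of y x] y0 Suc.prems order_le_degree le_neq_implies_less by blast
      then have "bounded_decay (?K * ?q + \<epsilon> / 2) y" using ny Suc.prems by (intro contract) auto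
      \<comment> \<open>Multiplicity \<open>d\<close> preserves the rate; only the slack grows from
        \<open>\<epsilon> / 2\<close> to \<open>\<epsilon>\<close>.\<close>
      moreover have "real (order y (f - [:x:])) * (?K * ?q + \<epsilon> / 2) < real d * (?K * ?q + \<epsilon>)"
      proof -
        have "real (order y (f - [:x:])) * (?K * ?q + \<epsilon> / 2) \<le> real d * (?K * ?q + \<epsilon> / 2)"
          using order_le_degree K d_pos Suc.prems
          by (intro mult_right_mono add_nonneg_nonneg mult_nonneg_nonneg) auto
        also have "\<dots> < real d * (?K * ?q + \<epsilon>)" using d_pos Suc.prems by (intro mult_strict_left_mono) auto
        finally show ?thesis .
      qed
      ultimately show "\<exists>\<theta>. real (order y (f - [:x:])) * \<theta> < real d * (?K * ?q + \<epsilon>) \<and> bounded_decay \<theta> y"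
        by blast
    qed
  qed
  then show ?case by (simp add: mult_ac)
qed

lemma bounded_decay_all:
  assumes x: "\<not> exceptional x" and \<theta>: "0 < \<theta>"
  shows "bounded_decay \<theta> x"
proof -
  have "(\<lambda>k. (\<bar>\<kappa>\<bar> + \<bar>ln r\<bar>) * ((real d - 1) / real d) ^ k) \<longlonglongrightarrow> (\<bar>\<kappa>\<bar> + \<bar>ln r\<bar>) * 0"
    using d_pos by (intro tendsto_mult tendsto_const LIMSEQ_power_zero) auto
  then have "\<forall>\<^sub>F k in sequentially. (\<bar>\<kappa>\<bar> + \<bar>ln r\<bar>) * ((real d - 1) / real d) ^ k < \<theta> / 2"
    using \<theta> by (intro order_tendstoD(2)) auto
  then obtain k where "(\<bar>\<kappa>\<bar> + \<bar>ln r\<bar>) * ((real d - 1) / real d) ^ k < \<theta> / 2"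
    using eventually_happens'[OF sequentially_bot] by blast
  then show ?thesis
    using bounded_decay_mono[OF bounded_decay_power[OF x, of "\<theta> / 2" k], of \<theta>] \<theta> by simp
qed

section \<open>Limits for bounded and for escaping orbits\<close>

lemma tendsto_ln_bounded_orbit:
  assumes bnd: "\<And>n. D (F n) \<le> escape_radius" and x: "\<not> exceptional x"
  shows "(\<lambda>n. ln (D (F n - [:x:])) / real d ^ n) \<longlonglongrightarrow> 0"
proof (rule LIMSEQ_I)
  fix e :: real assume e: "0 < e"
  define M where "M = ln (max escape_radius (N x)) + 1"
  have "bounded_decay (e / 2) x" using bounded_decay_all[OF x] e by simp
  moreover have "\<forall>\<^sub>F n in sequentially. M \<le> e * real d ^ n" by (rule eventually_le_d_power[OF e])
  ultimately have "\<forall>\<^sub>F n in sequentially. \<bar>ln (D (F n - [:x:])) / real d ^ n\<bar> < e"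
    unfolding bounded_decay_def
  proof eventually_elim
    case (elim n)
    have p: "0 < real d ^ n" using d_pos by simp
    have "D (F n - [:x:]) \<le> max (D (F n)) (N x)"
      using ultrametric_seminormD(8)[OF D, of "F n" "[:x:]"] ultrametric_seminormD(4)[OF D] by simp
    also have "\<dots> \<le> max escape_radius (N x)" using bnd[of n] by simp
    finally have "ln (D (F n - [:x:])) \<le> ln (max escape_radius (N x))"
      using D_iterate_pos by (subst ln_le_cancel_iff) (auto simp: less_max_iff_disj intro: less_le_trans[OF _ escape_radius_ge_1])
    then have "ln (D (F n - [:x:])) < e * real d ^ n" using elim(2) by (simp add: M_def)
    moreover have "- (e / 2) * real d ^ n > - e * real d ^ n" using e p by simp
    then have "- e * real d ^ n < ln (D (F n - [:x:]))" using elim(1) by linarith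
    ultimately show ?case using p by (simp add: abs_less_iff field_simps)
  qed
  then show "\<exists>no. \<forall>n\<ge>no. norm (ln (D (F n - [:x:])) / real d ^ n - 0) < e"
    by (simp add: eventually_sequentially)
qed

text \<open>Past the escape radius \<open>ln (D (F n)) + \<kappa>\<close> is multiplied by exactly
  \<open>d\<close> in each step, and \<open>x\<close> becomes invisible once \<open>D (F n)\<close>
  exceeds \<open>N x\<close>. In this case exceptional points behave like all others.\<close>

lemma tendsto_ln_escaping_orbit:
  assumes m: "escape_radius < D (F m)"
  shows "\<exists>c. \<forall>x. (\<lambda>n. ln (D (F n - [:x:])) / real d ^ n) \<longlonglongrightarrow> c"
proof -
  have T: "ultrametric_seminorm (\<lambda>p. D (p \<circ>\<^sub>p F n))" for n
    by (rule ultrametric_seminorm_pcompose[OF D])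
  have id: "[:0, 1:] \<circ>\<^sub>p p = p" for p :: "'a poly" by (simp add: pcompose_pCons)
  have esc: "D (F (Suc n)) = N (lead_coeff f) * D (F n) ^ d" "1 < N (lead_coeff f) * D (F n) ^ (d - 1)"
    "D (F n) < D (F (Suc n))" if "escape_radius < D (F n)" for n
    using escape[OF T, of n] escape_increasing[OF T, of n] that by (simp_all add: id poly_iterate_Suc)
  have far: "escape_radius < D (F (m + n))" for n
    by (induction n) (use m esc(3) less_trans in auto)
  have pos: "0 < D (F (m + n))" for n using far[of n] escape_radius_ge_1 by linarith
  define c where "c = (ln (D (F m)) + \<kappa>) / real d ^ m"
  have formula: "ln (D (F (m + n))) + \<kappa> = c * real d ^ (m + n)" for n
  proof (induction n)
    case (Suc n)
    have "ln (D (F (m + Suc n))) = (real d - 1) * \<kappa> + real d * ln (D (F (m + n)))"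
      using esc(1)[OF far, of n] pos[of n] lead_coeff_nz
      by (simp add: ln_mult ln_realpow ln_lead_coeff)
    also have "\<dots> = real d * (ln (D (F (m + n))) + \<kappa>) - \<kappa>" by (simp add: algebra_simps)
    finally show ?case using Suc by simp
  qed (use d_pos in \<open>simp add: c_def\<close>)
  \<comment> \<open>The second estimate in \<open>escape\<close> is precisely positivity of
    \<open>c\<close>, which makes \<open>D (F n)\<close> tend to infinity.\<close>
  have "0 < ln (N (lead_coeff f) * D (F m) ^ (d - 1))" using esc(2)[OF m] by (rule ln_gt_zero)
  also have "\<dots> = (real d - 1) * (ln (D (F m)) + \<kappa>)"
    using pos[of 0] lead_coeff_nz d_pos by (simp add: ln_mult ln_realpow ln_lead_coeff of_nat_diff algebra_simps)
  finally have c: "0 < c" using d_pos degree_gt_1 by (simp add: c_def zero_less_mult_iff)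
  have "(\<lambda>n. ln (D (F n - [:x:])) / real d ^ n) \<longlonglongrightarrow> c" for x
  proof -
    have "\<forall>\<^sub>F n in sequentially. ln (max 1 (N x)) + \<kappa> + 1 \<le> c * real d ^ n"
      by (rule eventually_le_d_power[OF c])
    moreover have "\<forall>\<^sub>F n in sequentially. m \<le> n" by (rule eventually_ge_at_top)
    ultimately have "\<forall>\<^sub>F n in sequentially. c - \<kappa> / real d ^ n = ln (D (F n - [:x:])) / real d ^ n"
    proof eventually_elim
      case (elim n)
      then obtain k where k: "n = m + k" using le_Suc_ex by blast
      have "ln (max 1 (N x)) < ln (D (F n))" using elim(1) formula[of k] by (simp add: k)
      then have "max 1 (N x) < D (F n)" using pos[of k] by (subst (asm) ln_less_cancel_iff) (auto simp: k)
      then have "D (F n - [:x:]) = D (F n)" using ultrametric_seminorm_far[OF D] by simp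
      then show ?case using formula[of k] d_pos by (simp add: k field_simps)
    qed
    moreover have "(\<lambda>n. c - \<kappa> / real d ^ n) \<longlonglongrightarrow> c - 0"
      by (intro tendsto_diff tendsto_const const_div_d_power)
    ultimately show ?thesis using tendsto_cong by fastforce
  qed
  then show ?thesis by blast
qed

lemma tendsto_ln:
  "\<exists>c. \<forall>x. \<not> exceptional x \<longrightarrow> (\<lambda>n. ln (D (F n - [:x:])) / real d ^ n) \<longlonglongrightarrow> c"
proof (cases "\<exists>m. escape_radius < D (F m)")
  case True
  then show ?thesis using tendsto_ln_escaping_orbit by blast
next
  case False
  then show ?thesis using tendsto_ln_bounded_orbit by (auto simp: not_less)
qed

end

section \<open>Means over iterated preimages\<close>

context nonarch_dynamics
begin

definition preimage_mean :: "nat \<Rightarrow> 'a \<Rightarrow> ('a \<Rightarrow> real) \<Rightarrow> real" where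
  "preimage_mean n x h = (\<Sum>y\<in>#proots (F n - [:x:]). h y) / real d ^ n"

definition equidistributed :: "('a \<Rightarrow> real) \<Rightarrow> bool" where
  "equidistributed h \<longleftrightarrow> (\<exists>L. \<forall>x. \<not> exceptional x \<longrightarrow> (\<lambda>n. preimage_mean n x h) \<longlonglongrightarrow> L)"

lemma size_iterate_preimages: "size (proots (F n - [:x:])) = d ^ n"
  by (simp only: size_proots F_diff_const(1) degree_poly_iterate)

lemma preimage_mean_add: "preimage_mean n x (\<lambda>y. g y + h y) = preimage_mean n x g + preimage_mean n x h"
  by (simp add: preimage_mean_def sum_mset.distrib add_divide_distrib)

lemma preimage_mean_scale: "preimage_mean n x (\<lambda>y. c * h y) = c * preimage_mean n x h"
  by (simp add: preimage_mean_def flip: sum_mset_distrib_left)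

lemma preimage_mean_const: "preimage_mean n x (\<lambda>_. c) = c"
  using d_pos by (simp add: preimage_mean_def size_iterate_preimages)

lemma preimage_mean_mono:
  assumes "\<And>y. (poly f ^^ n) y = x \<Longrightarrow> g y \<le> h y"
  shows "preimage_mean n x g \<le> preimage_mean n x h"
  unfolding preimage_mean_def
  by (intro divide_right_mono sum_mset_mono) (use assms iterate_preimage_iff in auto)

lemma preimage_mean_dist_le:
  assumes "\<And>y. (poly f ^^ n) y = x \<Longrightarrow> \<bar>g y - h y\<bar> \<le> e"
  shows "\<bar>preimage_mean n x g - preimage_mean n x h\<bar> \<le> e"
proof -
  have "preimage_mean n x g \<le> preimage_mean n x (\<lambda>y. h y + e)"
    by (rule preimage_mean_mono) (use assms in \<open>force simp: abs_le_iff\<close>)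
  moreover have "preimage_mean n x h \<le> preimage_mean n x (\<lambda>y. g y + e)"
    by (rule preimage_mean_mono) (use assms in \<open>force simp: abs_le_iff\<close>)
  ultimately show ?thesis by (simp add: preimage_mean_add preimage_mean_const)
qed

lemma equidistributed_add: "equidistributed g \<Longrightarrow> equidistributed h \<Longrightarrow> equidistributed (\<lambda>y. g y + h y)"
proof -
  assume "equidistributed g" "equidistributed h"
  then obtain L L' where L: "\<forall>x. \<not> exceptional x \<longrightarrow> (\<lambda>n. preimage_mean n x g) \<longlonglongrightarrow> L"
    "\<forall>x. \<not> exceptional x \<longrightarrow> (\<lambda>n. preimage_mean n x h) \<longlonglongrightarrow> L'"
    unfolding equidistributed_def by metis
  show ?thesis
    unfolding equidistributed_def preimage_mean_add
    using tendsto_add[OF L(1)[rule_format] L(2)[rule_format]] by (intro exI[of _ "L + L'"]) simp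
qed

lemma equidistributed_scale: "equidistributed h \<Longrightarrow> equidistributed (\<lambda>y. c * h y)"
proof -
  assume "equidistributed h"
  then obtain L where L: "\<forall>x. \<not> exceptional x \<longrightarrow> (\<lambda>n. preimage_mean n x h) \<longlonglongrightarrow> L"
    unfolding equidistributed_def by metis
  show ?thesis
    unfolding equidistributed_def preimage_mean_scale
    using tendsto_mult_left[OF L[rule_format]] by (intro exI[of _ "c * L"]) simp
qed

text \<open>All iterated preimages of two given points share a ball, so approximation on balls is
  enough. The limits of the approximants are not known to converge; the Cauchy criterion, applied to
  both sequences of means jointly, gives existence and independence of the point.\<close>

lemma equidistributed_locally_uniform_limit:
  assumes approx: "\<And>R e. 0 < e \<Longrightarrow> \<exists>g. equidistributed g \<and> (\<forall>y. N y \<le> R \<longrightarrow> \<bar>g y - h y\<bar> < e)"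
  shows "equidistributed h"
proof -
  have *: "\<exists>M. \<forall>m\<ge>M. \<forall>n\<ge>M. \<bar>preimage_mean m x h - preimage_mean n x' h\<bar> < e"
    if x: "\<not> exceptional x" "\<not> exceptional x'" and e: "0 < e" for x x' e
  proof -
    obtain g where g: "equidistributed g"
      "\<And>y. N y \<le> max escape_radius (max (N x) (N x')) \<Longrightarrow> \<bar>g y - h y\<bar> < e / 4"
      using approx[of "e / 4"] e by (metis divide_pos_pos zero_less_numeral)
    then obtain L where L: "(\<lambda>n. preimage_mean n x g) \<longlonglongrightarrow> L" "(\<lambda>n. preimage_mean n x' g) \<longlonglongrightarrow> L"
      using x unfolding equidistributed_def by blast
    have "\<forall>\<^sub>F n in sequentially. \<bar>preimage_mean n x g - L\<bar> < e / 4 \<and> \<bar>preimage_mean n x' g - L\<bar> < e / 4"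
      using tendstoD[OF L(1), of "e / 4"] tendstoD[OF L(2), of "e / 4"] e
      by (intro eventually_conj) (auto simp: dist_real_def)
    then obtain M where M: "\<And>n. n \<ge> M \<Longrightarrow> \<bar>preimage_mean n x g - L\<bar> < e / 4"
        "\<And>n. n \<ge> M \<Longrightarrow> \<bar>preimage_mean n x' g - L\<bar> < e / 4"
      by (auto simp: eventually_sequentially)
    have close: "\<bar>preimage_mean n w g - preimage_mean n w h\<bar> \<le> e / 4" if "w = x \<or> w = x'" for n w
    proof (rule preimage_mean_dist_le)
      fix y assume "(poly f ^^ n) y = w"
      then have "N y \<le> max escape_radius (max (N x) (N x'))" using norm_preimage_le[of n y w] that by auto
      then show "\<bar>g y - h y\<bar> \<le> e / 4" using g(2) by fastforce
    qed
    show ?thesis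
    proof (intro exI[of _ M] allI impI)
      fix m n assume "M \<le> m" "M \<le> n"
      then show "\<bar>preimage_mean m x h - preimage_mean n x' h\<bar> < e"
        using M(1)[of m] M(2)[of n] close[of x m] close[of x' n]
        unfolding abs_less_iff abs_le_iff by simp
    qed
  qed
  obtain x0 where x0: "\<not> exceptional x0" using exists_nonexceptional by blast
  have "Cauchy (\<lambda>n. preimage_mean n x0 h)"
    using *[OF x0 x0] by (simp add: Cauchy_def dist_real_def)
  then obtain L where L: "(\<lambda>n. preimage_mean n x0 h) \<longlonglongrightarrow> L"
    using Cauchy_convergent_iff convergent_def by blast
  have "(\<lambda>n. preimage_mean n x h) \<longlonglongrightarrow> L" if x: "\<not> exceptional x" for x
  proof -
    have "(\<lambda>n. preimage_mean n x h - preimage_mean n x0 h) \<longlonglongrightarrow> 0"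
    proof (rule LIMSEQ_I)
      fix e :: real assume "0 < e"
      from *[OF x x0 this] obtain M where
        "\<forall>m\<ge>M. \<forall>n\<ge>M. \<bar>preimage_mean m x h - preimage_mean n x0 h\<bar> < e" ..
      then show "\<exists>M. \<forall>n\<ge>M. norm (preimage_mean n x h - preimage_mean n x0 h - 0) < e"
        by (intro exI[of _ M]) simp
    qed
    from tendsto_add[OF this L] show ?thesis by simp
  qed
  then show ?thesis unfolding equidistributed_def by blast
qed

lemma sum_mset_ln:
  fixes g :: "'b \<Rightarrow> real"
  assumes "\<And>y. 0 < g y"
  shows "ln (\<Prod>y\<in>#A. g y) = (\<Sum>y\<in>#A. ln (g y))" "0 < (\<Prod>y\<in>#A. g y)"
proof -
  have "ln (\<Prod>y\<in>#A. g y) = (\<Sum>y\<in>#A. ln (g y)) \<and> 0 < (\<Prod>y\<in>#A. g y)"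
    by (induction A) (simp_all add: ln_mult_pos assms)
  then show "ln (\<Prod>y\<in>#A. g y) = (\<Sum>y\<in>#A. ln (g y))" "0 < (\<Prod>y\<in>#A. g y)" by blast+
qed

text \<open>The mean is the logarithm of a disc norm divided by \<open>d^n\<close>, minus the share
  of the leading coefficient, which tends to \<open>\<kappa>\<close>.\<close>

lemma equidistributed_ln_max:
  assumes r: "0 < r"
  shows "equidistributed (\<lambda>y. ln (max (N (y - a)) r))"
proof -
  interpret nonarch_dynamics_seminorm N f "disc_norm a r" r
    by unfold_locales (auto simp: r ultrametric_seminorm_disc_norm disc_norm_linear)
  obtain c where c: "\<And>x. \<not> exceptional x \<Longrightarrow> (\<lambda>n. ln (disc_norm a r (F n - [:x:])) / real d ^ n) \<longlonglongrightarrow> c"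
    using tendsto_ln by blast
  have pm: "preimage_mean n x (\<lambda>y. ln (max (N (y - a)) r)) =
      ln (disc_norm a r (F n - [:x:])) / real d ^ n - (\<kappa> - \<kappa> / real d ^ n)" for n x
  proof -
    have p: "0 < max (N (y - a)) r" for y using r by simp
    have "ln (disc_norm a r (F n - [:x:])) =
        ln (N (lead_coeff (F n))) + (\<Sum>y\<in>#proots (F n - [:x:]). ln (max (N (y - a)) r))"
      unfolding disc_norm_prod_roots[OF r] F_diff_const(2)
      using lead_coeff_iterate_nz[of n] sum_mset_ln(2)[of "\<lambda>y. max (N (y - a)) r", OF p]
      by (subst ln_mult_pos) (simp_all add: sum_mset_ln(1)[OF p])
    then show ?thesis using d_pos
      by (simp add: preimage_mean_def ln_lead_coeff_iterate field_simps)
  qed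
  have "(\<lambda>n. preimage_mean n x (\<lambda>y. ln (max (N (y - a)) r))) \<longlonglongrightarrow> c - (\<kappa> - 0)" if "\<not> exceptional x" for x
    unfolding pm by (intro tendsto_diff c that tendsto_const const_div_d_power)
  then show ?thesis unfolding equidistributed_def by blast
qed

end

section \<open>Continuous functions on the Berkovich line\<close>

text \<open>Up to the factor \<open>h\<close> the summands are the tent functions of piecewise linear interpolation; on
  the grid interval the right-hand side is \<open>h\<close>.\<close>

lemma sum_tents:
  fixes t h \<alpha> :: real
  shows "(\<Sum>i\<le>n. max t (\<alpha> + real i * h - h) - 2 * max t (\<alpha> + real i * h) + max t (\<alpha> + real i * h + h)) =
    max t (\<alpha> + real n * h + h) - max t (\<alpha> + real n * h) - max t \<alpha> + max t (\<alpha> - h)"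
  by (induction n) (simp_all add: distrib_right)

text \<open>\<open>P\<close> will be equidistribution of a function of the logarithmic distance,
  which is first known only for maxima with a constant. Interpolating functions are combinations of
  such maxima.\<close>

lemma piecewise_linear_approx:
  fixes v :: "real \<Rightarrow> real"
  assumes v: "continuous_on {\<alpha>..\<beta>} v" and lt: "\<alpha> < \<beta>" and e: "0 < e"
    and P_max: "\<And>s. P (\<lambda>t. max t s)"
    and P_add: "\<And>g h. P g \<Longrightarrow> P h \<Longrightarrow> P (\<lambda>t. g t + h t)"
    and P_scale: "\<And>c g. P g \<Longrightarrow> P (\<lambda>t. c * g t)"
  shows "\<exists>g. P g \<and> (\<forall>t\<in>{\<alpha>..\<beta>}. \<bar>v t - g t\<bar> < e)"
proof -
  have "uniformly_continuous_on {\<alpha>..\<beta>} v" by (intro compact_uniformly_continuous v) simp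
  then obtain \<delta> where \<delta>: "0 < \<delta>"
      "\<And>s t. s \<in> {\<alpha>..\<beta>} \<Longrightarrow> t \<in> {\<alpha>..\<beta>} \<Longrightarrow> \<bar>s - t\<bar> < \<delta> \<Longrightarrow> \<bar>v s - v t\<bar> < e / 2"
    unfolding uniformly_continuous_on_def dist_real_def using e by (meson half_gt_zero)
  obtain m where m: "(\<beta> - \<alpha>) / \<delta> < real m" using reals_Archimedean2 by blast
  define n where "n = Suc m"
  define h where "h = (\<beta> - \<alpha>) / real n"
  have n: "0 < real n" "(\<beta> - \<alpha>) / \<delta> < real n" using m by (auto simp: n_def)
  have h: "0 < h" "h < \<delta>" "\<alpha> + real n * h = \<beta>"
    using n lt \<delta>(1) by (auto simp: h_def field_simps)
  define s where "s i = \<alpha> + real i * h" for i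
  \<comment> \<open>A hat around \<open>s i\<close>, written as a second difference of
    maxima.\<close>
  define tent where "tent i t = (1 / h) * (max t (s i - h) + (-2) * max t (s i) + max t (s i + h))" for i t
  have tent0: "tent i t = 0" if "h \<le> \<bar>t - s i\<bar>" for i t
    using that h(1) by (auto simp: tent_def max_def abs_if split: if_splits)
  have tent_nonneg: "0 \<le> tent i t" for i t
    using h(1) by (auto simp: tent_def max_def)
  have tent_sum: "(\<Sum>i\<le>n. tent i t) = 1" if "t \<in> {\<alpha>..\<beta>}" for t
  proof -
    have "(\<Sum>i\<le>n. tent i t) = (1 / h) * (\<Sum>i\<le>n. max t (s i - h) - 2 * max t (s i) + max t (s i + h))"
      unfolding sum_distrib_left tent_def by (rule sum.cong) auto
    also have "\<dots> = (1 / h) * (max t (\<beta> + h) - max t \<beta> - max t \<alpha> + max t (\<alpha> - h))"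
      unfolding s_def sum_tents h(3) ..
    also have "\<dots> = 1" using that h(1) by simp
    finally show ?thesis .
  qed
  define g where "g t = (\<Sum>i\<le>n. v (s i) * tent i t)" for t
  have P_tent: "P (tent i)" for i
    unfolding tent_def by (intro P_scale P_add P_max)
  have P_sum: "P (\<lambda>t. \<Sum>i\<le>k. v (s i) * tent i t)" for k
    by (induction k) (auto intro!: P_add P_scale P_tent)
  have s: "s i \<in> {\<alpha>..\<beta>}" if "i \<le> n" for i
  proof -
    have "real i * h \<le> real n * h" using that h(1) by (intro mult_right_mono) auto
    then show ?thesis using h(1) unfolding s_def h(3)[symmetric] by simp
  qed
  have "\<bar>v t - g t\<bar> < e" if t: "t \<in> {\<alpha>..\<beta>}" for t
  proof -
    \<comment> \<open>The tents sum to 1, so the error is a weighted mean of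
      \<open>v t - v (s i)\<close>, with weight only on grid points within \<open>h\<close> of
      \<open>t\<close>.\<close>
    have "v t - g t = (\<Sum>i\<le>n. (v t - v (s i)) * tent i t)"
      using tent_sum[OF t] by (simp add: g_def left_diff_distrib sum_subtractf flip: sum_distrib_left)
    also have "\<bar>\<dots>\<bar> \<le> (\<Sum>i\<le>n. \<bar>(v t - v (s i)) * tent i t\<bar>)" by (rule sum_abs)
    also have "\<dots> \<le> (\<Sum>i\<le>n. (e / 2) * tent i t)"
    proof (rule sum_mono)
      fix i assume "i \<in> {..n}"
      then have si: "s i \<in> {\<alpha>..\<beta>}" by (intro s) simp
      show "\<bar>(v t - v (s i)) * tent i t\<bar> \<le> (e / 2) * tent i t"
      proof (cases "h \<le> \<bar>t - s i\<bar>")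
        case False
        then have "\<bar>v t - v (s i)\<bar> < e / 2" using \<delta>(2)[OF t si] h(2) by linarith
        then show ?thesis
          unfolding abs_mult abs_of_nonneg[OF tent_nonneg] by (intro mult_right_mono tent_nonneg) simp
      qed (simp add: tent0)
    qed
    also have "\<dots> = e / 2" unfolding sum_distrib_left[symmetric] tent_sum[OF t] by simp
    finally show ?thesis using e by simp
  qed
  moreover have "P g" unfolding g_def by (rule P_sum)
  ultimately show ?thesis by blast
qed

text \<open>The library states the Stone-Weierstrass theorem for types of class \<open>t2_space\<close>. Function
  types cannot be made an instance, because of the existing metric on functions with countable
  domain, hence the copy \<open>real_family\<close>.\<close>

typedef 'i real_family = "UNIV :: ('i \<Rightarrow> real) set"
  morphisms coordinates Family ..

instantiation real_family :: (type) t2_space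
begin

definition open_real_family :: "'a real_family set \<Rightarrow> bool" where
  "open_real_family U \<longleftrightarrow> open (Family -` U)"

instance
proof
  show "open (UNIV :: 'a real_family set)" by (simp add: open_real_family_def)
  show "open (U \<inter> V)" if "open U" "open V" for U V :: "'a real_family set"
    using that by (simp add: open_real_family_def open_Int)
  show "open (\<Union>K)" if "\<forall>U\<in>K. open U" for K :: "'a real_family set set"
    using that by (simp add: open_real_family_def vimage_Union open_UN)
  fix x y :: "'a real_family" assume "x \<noteq> y"
  then obtain i where i: "coordinates x i \<noteq> coordinates y i" by (metis coordinates_inject ext)
  obtain U V where UV: "open U" "open V" "coordinates x i \<in> U" "coordinates y i \<in> V" "U \<inter> V = {}"
    using hausdorff[OF i] by blast
  have "open ((\<lambda>z. coordinates z i) -` W)" if "open W" for W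
  proof -
    have "Family -` ((\<lambda>z. coordinates z i) -` W) = (\<lambda>g. g i) -` W"
      by (auto simp: Family_inverse)
    then show ?thesis
      using open_vimage[OF that continuous_on_product_coordinates] by (simp add: open_real_family_def)
  qed
  with UV show "\<exists>U V. open U \<and> open V \<and> x \<in> U \<and> y \<in> V \<and> U \<inter> V = {}"
    by (intro exI[of _ "(\<lambda>z. coordinates z i) -` U"] exI[of _ "(\<lambda>z. coordinates z i) -` V"]) auto
qed

end

lemma continuous_on_Family: "continuous_on UNIV Family"
  by (simp add: continuous_on_open_vimage open_real_family_def)

lemma continuous_on_coordinates: "continuous_on UNIV (coordinates :: 'i real_family \<Rightarrow> _)"
proof -
  have "Family -` (coordinates -` U) = U" for U :: "('i \<Rightarrow> real) set" by (auto simp: Family_inverse)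
  then show ?thesis by (simp add: continuous_on_open_vimage open_real_family_def)
qed

lemma Stone_Weierstrass_functions:
  fixes S :: "('i \<Rightarrow> real) set"
  assumes S: "compact S" and const: "\<And>c. P (\<lambda>x. c::real)"
    and cont: "\<And>w. P w \<Longrightarrow> continuous_on S w"
    and add: "\<And>v w. P v \<Longrightarrow> P w \<Longrightarrow> P (\<lambda>x. v x + w x)"
    and mult: "\<And>v w. P v \<Longrightarrow> P w \<Longrightarrow> P (\<lambda>x. v x * w x)"
    and sep: "\<And>x y. x \<in> S \<Longrightarrow> y \<in> S \<Longrightarrow> x \<noteq> y \<Longrightarrow> \<exists>w. P w \<and> w x \<noteq> w y"
    and h: "continuous_on S h" and e: "0 < e"
  shows "\<exists>w. P w \<and> (\<forall>x\<in>S. \<bar>h x - w x\<bar> < e)"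
proof -
  have cS: "continuous_on (Family ` S) (\<lambda>x. w (coordinates x))" if "continuous_on S w" for w
    by (rule continuous_on_compose2[OF that continuous_on_subset[OF continuous_on_coordinates]])
       (auto simp: Family_inverse)
  have "\<exists>w. P (\<lambda>x. w (Family x)) \<and> (\<forall>x\<in>Family ` S. \<bar>h (coordinates x) - w x\<bar> < e)"
  proof (rule Stone_Weierstrass_HOL[where P = "\<lambda>w. P (\<lambda>x. w (Family x))"])
    show "compact (Family ` S)"
      by (intro compact_continuous_image continuous_on_subset[OF continuous_on_Family] S) simp
    show "continuous_on (Family ` S) w" if "P (\<lambda>x. w (Family x))" for w
      using cS[OF cont[OF that]] by (simp add: coordinates_inverse)
    show "continuous_on (Family ` S) (\<lambda>x. h (coordinates x))" by (rule cS[OF h])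
    fix x y assume xy: "x \<in> Family ` S \<and> y \<in> Family ` S \<and> x \<noteq> y"
    then have "coordinates x \<in> S" "coordinates y \<in> S" "coordinates x \<noteq> coordinates y"
      by (auto simp: Family_inverse coordinates_inject)
    then obtain w where "P w" "w (coordinates x) \<noteq> w (coordinates y)" using sep by blast
    then show "\<exists>w. P (\<lambda>x. w (Family x)) \<and> w x \<noteq> w y"
      by (intro exI[of _ "\<lambda>x. w (coordinates x)"]) (simp add: Family_inverse)
  qed (use const add mult e in auto)
  then show ?thesis by (auto simp: Family_inverse)
qed

section \<open>Topology of the Berkovich line\<close>

lemma berkovich_line_eq: "berkovich_line N = top_of_set {S. berkovich_seminorm N S}"
  unfolding berkovich_line_def euclidean_product_topology ..

lemma completely_regular_berkovich_line: "completely_regular_space (berkovich_line N)"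
  unfolding berkovich_line_def
  by (intro completely_regular_space_subtopology)
     (auto simp: completely_regular_space_product_topology
       intro!: metrizable_imp_completely_regular_space metrizable_space_euclidean)

lemma Hausdorff_berkovich_line: "Hausdorff_space (berkovich_line N)"
  unfolding berkovich_line_def
  by (intro Hausdorff_space_subtopology) (simp add: Hausdorff_space_product_topology)

lemma closed_berkovich_seminorms: "closed {S. berkovich_seminorm N S}"
  unfolding berkovich_seminorm_def
  by (intro closed_Collect_conj closed_Collect_all closed_Collect_le closed_Collect_eq
      continuous_on_mult continuous_on_add continuous_on_const continuous_on_product_coordinates)

text \<open>A bound at the coordinate propagates to every polynomial by Horner's scheme. A ball is
  thus a closed subset of a product of compact intervals, and Tychonoff's theorem applies.\<close>

lemma berkovich_seminorm_bounded:
  assumes N: "\<And>c. 0 \<le> N c"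
  shows "\<exists>B. \<forall>S. berkovich_seminorm N S \<and> S [:0, 1:] \<le> R \<longrightarrow> S p \<le> B"
proof (induction p)
  case 0
  have "S 0 \<le> N 0" if "berkovich_seminorm N S" for S
    using that unfolding berkovich_seminorm_def by (metis order_refl pCons_0_0)
  then show ?case by blast
next
  case (pCons a p)
  then obtain B where B: "\<And>S. berkovich_seminorm N S \<Longrightarrow> S [:0, 1:] \<le> R \<Longrightarrow> S p \<le> B" by blast
  have "S (pCons a p) \<le> N a + R * B" if S: "berkovich_seminorm N S" "S [:0, 1:] \<le> R" for S
  proof -
    have S': "0 \<le> S q" "S (q * q') = S q * S q'" "S (q + q') \<le> S q + S q'" "S [:c:] = N c" for q q' c
      using S(1) by (auto simp: berkovich_seminorm_def)
    have "pCons a p = [:a:] + [:0, 1:] * p" by simp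
    then have "S (pCons a p) \<le> N a + S [:0, 1:] * S p" using S'(2-4) by metis
    also have "S [:0, 1:] * S p \<le> R * B" using S B S'(1) by (intro mult_mono) (auto intro: order_trans[OF S'(1)])
    finally show ?thesis by simp
  qed
  then show ?case by blast
qed

lemma compact_berkovich_ball:
  assumes N: "\<And>c. 0 \<le> N c"
  shows "compact {S. berkovich_seminorm N S \<and> S [:0, 1:] \<le> R}" (is "compact ?Z")
proof -
  obtain B where B: "\<And>p S. berkovich_seminorm N S \<Longrightarrow> S [:0, 1:] \<le> R \<Longrightarrow> S p \<le> B p"
    using berkovich_seminorm_bounded[of N R, OF N] by metis
  have "compactin (product_topology (\<lambda>_. euclideanreal) UNIV) (\<Pi>\<^sub>E p\<in>UNIV. {0..B p})"
    by (subst compactin_PiE) simp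
  then have "compact (\<Pi>\<^sub>E p\<in>UNIV. {0..B p})" by (simp add: euclidean_product_topology)
  moreover have "closed ?Z"
    by (intro closed_Collect_conj closed_berkovich_seminorms[unfolded mem_Collect_eq] closed_Collect_le
        continuous_on_const continuous_on_product_coordinates)
  moreover have "?Z \<subseteq> (\<Pi>\<^sub>E p\<in>UNIV. {0..B p})"
    using B by (auto simp: berkovich_seminorm_def)
  ultimately show ?thesis
    using compact_Int_closed[of "\<Pi>\<^sub>E p\<in>UNIV. {0..B p}" ?Z] by (simp only: Int_absorb1)
qed

section \<open>Radial functions on ultrametric seminorms\<close>

context nonarch_field
begin

lemma ultrametric_imp_berkovich: "ultrametric_seminorm S \<Longrightarrow> berkovich_seminorm N S"
  unfolding ultrametric_seminorm_def berkovich_seminorm_def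
  by (meson max.bounded_iff le_add_same_cancel1 le_add_same_cancel2 order_trans max_def)

definition ultrametric_ball :: "real \<Rightarrow> ('a poly \<Rightarrow> real) set" where
  "ultrametric_ball R = {S. ultrametric_seminorm S \<and> S [:0, 1:] \<le> R}"

lemma compact_ultrametric_ball: "compact (ultrametric_ball R)"
proof -
  have "closed {S. ultrametric_seminorm S}"
    unfolding ultrametric_seminorm_def
    by (intro closed_Collect_conj closed_Collect_all closed_Collect_le closed_Collect_eq
        continuous_on_mult continuous_on_max continuous_on_const continuous_on_product_coordinates)
  then have "compact ({S. berkovich_seminorm N S \<and> S [:0, 1:] \<le> R} \<inter> {S. ultrametric_seminorm S})"
    by (intro compact_Int_closed compact_berkovich_ball norm_nonneg)
  also have "\<dots> = ultrametric_ball R"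
    using ultrametric_imp_berkovich by (auto simp: ultrametric_ball_def)
  finally show ?thesis .
qed

lemma closed_point_in_ultrametric_ball: "N y \<le> R \<Longrightarrow> closed_point N y \<in> ultrametric_ball R"
  using ultrametric_seminorm_closed_point by (simp add: ultrametric_ball_def closed_point_def)

text \<open>Provides the separation of points for Stone-Weierstrass.\<close>

lemma ultrametric_seminorm_eqI:
  assumes "ultrametric_seminorm S" "ultrametric_seminorm T" "\<And>a. S [:- a, 1:] = T [:- a, 1:]"
  shows "S = T"
proof
  fix p
  show "S p = T p"
    unfolding ultrametric_seminorm_prod_roots[OF assms(1), of p]
      ultrametric_seminorm_prod_roots[OF assms(2), of p] assms(3) ..
qed

text \<open>Sums of continuous functions of a single distance \<open>S [:- a, 1:]\<close>. The
  equations are imposed on ultrametric seminorms only, so that a product may be replaced by a sum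
  that agrees with it there.\<close>

inductive radial_combination :: "(('a poly \<Rightarrow> real) \<Rightarrow> real) \<Rightarrow> bool" where
  radial: "continuous_on {0..} u \<Longrightarrow> (\<And>S. ultrametric_seminorm S \<Longrightarrow> w S = u (S [:- a, 1:])) \<Longrightarrow>
    radial_combination w"
| add: "radial_combination v \<Longrightarrow> radial_combination v' \<Longrightarrow>
    (\<And>S. ultrametric_seminorm S \<Longrightarrow> w S = v S + v' S) \<Longrightarrow> radial_combination w"

text \<open>Two of the three numbers \<open>S (z - a)\<close>, \<open>S (z - b)\<close>, \<open>N (a - b)\<close> agree and are at least as large
  as the third one.\<close>

lemma radial_mult:
  assumes u: "continuous_on {0..} u" and v: "continuous_on {0..} v"
    and w: "\<And>S. ultrametric_seminorm S \<Longrightarrow> w S = u (S [:- a, 1:]) * v (S [:- b, 1:])"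
  shows "radial_combination w"
proof -
  define D where "D = N (a - b)"
  have D: "0 \<le> D" by (simp add: D_def)
  have c: "continuous_on {0..} (\<lambda>t. q (min t D))" "continuous_on {0..} (\<lambda>t. q (max t D))"
    if "continuous_on {0..} q" for q :: "real \<Rightarrow> real"
    using D by (auto intro!: continuous_on_compose2[OF that] continuous_intros)
  \<comment> \<open>With \<open>s\<close>, \<open>t\<close> the values at \<open>z - a\<close>,
    \<open>z - b\<close>: if one is below \<open>D\<close> the other equals \<open>D\<close>, and
    otherwise they agree. Truncation at \<open>D\<close> isolates each regime, and the final
    constant removes the two surplus terms \<open>u D * v D\<close>.\<close>
  have 1: "radial_combination (\<lambda>S. u (min (S [:- a, 1:]) D) * v D)"
    by (rule radial[of "\<lambda>t. u (min t D) * v D" _ a]) (auto intro!: continuous_intros c u)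
  have 2: "radial_combination (\<lambda>S. u D * v (min (S [:- b, 1:]) D))"
    by (rule radial[of "\<lambda>t. u D * v (min t D)" _ b]) (auto intro!: continuous_intros c v)
  have 3: "radial_combination (\<lambda>S. u (max (S [:- a, 1:]) D) * v (max (S [:- a, 1:]) D) - 2 * u D * v D)"
    by (rule radial[of "\<lambda>t. u (max t D) * v (max t D) - 2 * u D * v D" _ a])
       (auto intro!: continuous_intros c u v)
  have 4: "radial_combination (\<lambda>S. u (min (S [:- a, 1:]) D) * v D + u D * v (min (S [:- b, 1:]) D))"
    by (rule add[OF 1 2]) simp
  show ?thesis
  proof (rule add[OF 4 3])
    fix S assume S: "ultrametric_seminorm S"
    note m = ultrametric_seminormD(3,4,8)[OF S]
    let ?s = "S [:- a, 1:]" and ?t = "S [:- b, 1:]"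
    have eqs: "[:- b, 1:] - [:a - b:] = [:- a, 1:]" "[:- a, 1:] + [:a - b:] = [:- b, 1:]"
      "[:- b, 1:] - [:- a, 1:] = [:a - b:]" by simp_all
    have "?s \<le> max ?t D" using m(3)[of "[:- b, 1:]" "[:a - b:]"] unfolding eqs m(2) D_def .
    moreover have "?t \<le> max ?s D" using m(1)[of "[:- a, 1:]" "[:a - b:]"] unfolding eqs m(2) D_def .
    moreover have "D \<le> max ?t ?s" using m(3)[of "[:- b, 1:]" "[:- a, 1:]"] unfolding eqs m(2) D_def .
    ultimately consider "?s < D" "?t = D" | "?t < D" "?s = D" | "D \<le> ?s" "?s = ?t" by linarith
    then show "w S = (u (min ?s D) * v D + u D * v (min ?t D)) + (u (max ?s D) * v (max ?s D) - 2 * u D * v D)"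
      by cases (simp_all add: w[OF S])
  qed
qed

lemma radial_combination_mult:
  assumes "radial_combination v" "radial_combination v'"
    and "\<And>S. ultrametric_seminorm S \<Longrightarrow> w S = v S * v' S"
  shows "radial_combination w"
  using assms
proof (induction arbitrary: w rule: radial_combination.induct)
  case (radial u v a)
  from radial.prems radial.hyps show ?case
  proof (induction arbitrary: w rule: radial_combination.induct)
    case (radial u' v' b)
    show ?case by (rule radial_mult[of u u' _ a b]) (use radial in auto)
  next
    case (add g g' v')
    have "radial_combination (\<lambda>S. v S * g S)" "radial_combination (\<lambda>S. v S * g' S)"
      using add by auto
    then show ?case by (rule radial_combination.add) (use add in \<open>simp add: distrib_left\<close>)
  qed
next
  case (add g g' v)
  have "radial_combination (\<lambda>S. g S * v' S)" "radial_combination (\<lambda>S. g' S * v' S)"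
    using add by auto
  then show ?case by (rule radial_combination.add) (use add in \<open>simp add: distrib_right\<close>)
qed

lemma continuous_on_radial_combination:
  assumes "radial_combination w"
  shows "continuous_on (ultrametric_ball R) w"
  using assms
proof induction
  case (radial u w a)
  have "continuous_on (ultrametric_ball R) (\<lambda>S. u (S [:- a, 1:]))"
    by (rule continuous_on_compose2[OF radial(1)])
       (auto simp: ultrametric_ball_def ultrametric_seminorm_def
         intro: continuous_on_subset[OF continuous_on_product_coordinates])
  then show ?case by (subst continuous_on_cong[OF refl]) (auto simp: radial ultrametric_ball_def)
next
  case (add v v' w)
  have "continuous_on (ultrametric_ball R) (\<lambda>S. v S + v' S)" by (intro continuous_on_add add)
  then show ?case by (subst continuous_on_cong[OF refl]) (auto simp: add ultrametric_ball_def)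
qed

lemma radial_combination_dense:
  assumes "continuous_on (ultrametric_ball R) h" "0 < e"
  shows "\<exists>w. radial_combination w \<and> (\<forall>S\<in>ultrametric_ball R. \<bar>h S - w S\<bar> < e)"
proof (rule Stone_Weierstrass_functions[OF compact_ultrametric_ball])
  show "radial_combination (\<lambda>_. c)" for c by (rule radial[of "\<lambda>_. c"]) auto
  show "radial_combination (\<lambda>S. v S + w S)" if "radial_combination v" "radial_combination w" for v w
    by (rule add[OF that]) simp
  show "radial_combination (\<lambda>S. v S * w S)" if "radial_combination v" "radial_combination w" for v w
    by (rule radial_combination_mult[OF that]) simp
  fix S T assume ST: "S \<in> ultrametric_ball R" "T \<in> ultrametric_ball R" "S \<noteq> T"
  then obtain a where "S [:- a, 1:] \<noteq> T [:- a, 1:]"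
    using ultrametric_seminorm_eqI by (auto simp: ultrametric_ball_def)
  moreover have "radial_combination (\<lambda>S. S [:- a, 1:])"
    by (rule radial[of "\<lambda>t. t" _ a]) (auto intro: continuous_intros)
  ultimately show "\<exists>w. radial_combination w \<and> w S \<noteq> w T" by blast
qed (use assms continuous_on_radial_combination in auto)

end

section \<open>Equidistribution for continuous test functions\<close>

context nonarch_dynamics
begin

text \<open>In the variable \<open>t = ln (max (N (y - a)) r)\<close> the function
  \<open>u (exp t)\<close> lives on a compact interval, and \<open>max t s\<close> is the same
  logarithm with radius \<open>max r (exp s)\<close>. The cutoff \<open>r\<close> avoids the pole of
  the logarithm; closer to \<open>a\<close>, \<open>u\<close> is nearly \<open>u 0\<close>.\<close>

lemma equidistributed_radial:
  assumes u: "continuous_on {0..} u"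
  shows "equidistributed (\<lambda>y. u (N (y - a)))"
proof (rule equidistributed_locally_uniform_limit)
  fix R e :: real assume e: "0 < e"
  \<comment> \<open>\<open>N a\<close> lets \<open>R'\<close> bound the distance to \<open>a\<close>
    on the ball; the 1 keeps \<open>R'\<close> above \<open>r\<close>.\<close>
  define R' where "R' = max (max R (N a)) 1"
  obtain \<delta> where \<delta>: "0 < \<delta>" "\<And>t. 0 \<le> t \<Longrightarrow> t < \<delta> \<Longrightarrow> \<bar>u t - u 0\<bar> < e / 4"
    using u[unfolded continuous_on_iff, rule_format, of 0 "e / 4"] e by (auto simp: dist_real_def)
  define r where "r = min (\<delta> / 2) (1 / 2)"
  have r: "0 < r" "r < \<delta>" "r < R'" using \<delta>(1) by (auto simp: r_def R'_def)
  have exp_ln: "exp (ln t) = t" if "r \<le> t" for t using that r by simp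
  let ?P = "\<lambda>g. equidistributed (\<lambda>y. g (ln (max (N (y - a)) r)))"
  have "\<exists>g. ?P g \<and> (\<forall>t\<in>{ln r..ln R'}. \<bar>u (exp t) - g t\<bar> < e / 2)"
  proof (rule piecewise_linear_approx)
    show "continuous_on {ln r..ln R'} (\<lambda>t. u (exp t))"
      by (rule continuous_on_compose2[OF u]) (auto intro: continuous_intros)
    show "ln r < ln R'" using r by simp
    show "?P (\<lambda>t. max t s)" for s
    proof -
      have "max (ln (max (N (y - a)) r)) s = ln (max (N (y - a)) (max r (exp s)))" for y
      proof -
        have "ln (max p q) = max (ln p) (ln q)" if "0 < p" "0 < q" for p q :: real
          using that by (simp add: max_def)
        from this[of "max (N (y - a)) r" "exp s"] show ?thesis using r by (simp add: max.assoc less_max_iff_disj)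
      qed
      then show ?thesis using equidistributed_ln_max[of "max r (exp s)" a] r by simp
    qed
  qed (use e in \<open>auto intro: equidistributed_add equidistributed_scale\<close>)
  then obtain g where g: "?P g" "\<And>t. t \<in> {ln r..ln R'} \<Longrightarrow> \<bar>u (exp t) - g t\<bar> < e / 2" by blast
  have "\<bar>g (ln (max (N (y - a)) r)) - u (N (y - a))\<bar> < e" if y: "N y \<le> R" for y
  proof -
    have le: "N (y - a) \<le> R'" using norm_diff_le[of y a] y by (simp add: R'_def)
    have approx: "\<bar>u t - g (ln t)\<bar> < e / 2" if "r \<le> t" "t \<le> R'" for t
      using g(2)[of "ln t"] that r exp_ln by simp
    show ?thesis
    proof (cases "r \<le> N (y - a)")
      case True
      then show ?thesis using approx[OF True le] e unfolding abs_less_iff by (simp add: max_absorb1)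
    next
      case False
      then have "\<bar>u (N (y - a)) - u 0\<bar> < e / 4" using \<delta>(2) r by simp
      moreover have "\<bar>u r - u 0\<bar> < e / 4" using \<delta>(2)[of r] r by simp
      moreover have "\<bar>u r - g (ln r)\<bar> < e / 2" using approx[of r] r by simp
      ultimately show ?thesis using False unfolding abs_less_iff by (simp add: max_absorb2)
    qed
  qed
  with g(1) show "\<exists>g. equidistributed g \<and> (\<forall>y. N y \<le> R \<longrightarrow> \<bar>g y - u (N (y - a))\<bar> < e)"
    by blast
qed

lemma equidistributed_radial_combination:
  assumes "radial_combination w"
  shows "equidistributed (\<lambda>y. w (closed_point N y))"
  using assms
proof induction
  case (radial u w a)
  then have "w (closed_point N y) = u (N (y - a))" for y
    using radial(2)[OF ultrametric_seminorm_closed_point] by (simp add: closed_point_def)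
  then show ?case using equidistributed_radial[OF radial(1)] by simp
next
  case (add v v' w)
  then have "w (closed_point N y) = v (closed_point N y) + v' (closed_point N y)" for y
    using ultrametric_seminorm_closed_point by simp
  then show ?case using equidistributed_add add.IH by simp
qed

lemma equidistributed_continuous:
  assumes "continuous_map (berkovich_line N) euclideanreal h"
  shows "equidistributed (\<lambda>y. h (closed_point N y))"
proof (rule equidistributed_locally_uniform_limit)
  fix R e :: real assume e: "0 < e"
  have "continuous_on {S. berkovich_seminorm N S} h"
    using assms unfolding berkovich_line_eq by simp
  then have "continuous_on (ultrametric_ball R) h"
    by (rule continuous_on_subset) (auto simp: ultrametric_ball_def intro: ultrametric_imp_berkovich)
  then obtain w where w: "radial_combination w" "\<And>S. S \<in> ultrametric_ball R \<Longrightarrow> \<bar>h S - w S\<bar> < e"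
    using radial_combination_dense e by blast
  have "\<bar>w (closed_point N y) - h (closed_point N y)\<bar> < e" if "N y \<le> R" for y
    using w(2)[OF closed_point_in_ultrametric_ball[OF that]] by (simp add: abs_minus_commute)
  then show "\<exists>g. equidistributed g \<and> (\<forall>y. N y \<le> R \<longrightarrow> \<bar>g y - h (closed_point N y)\<bar> < e)"
    using equidistributed_radial_combination[OF w(1)] by blast
qed

end

section \<open>The equilibrium measure\<close>

lemma sum_mset_eq_sum_count:
  fixes h :: "'b \<Rightarrow> real"
  assumes "finite A" "set_mset M \<subseteq> A"
  shows "(\<Sum>y\<in>#M. h y) = (\<Sum>y\<in>A. real (count M y) * h y)"
  using assms(2)
proof (induction M)
  case (add a M)
  have "(\<Sum>y\<in>A. real (count (add_mset a M) y) * h y) =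
      (\<Sum>y\<in>A. (if y = a then h y else 0) + real (count M y) * h y)"
    by (rule sum.cong) (auto simp: distrib_right)
  also have "\<dots> = h a + (\<Sum>y\<in>A. real (count M y) * h y)"
    using add.prems assms(1) by (simp add: sum.distrib sum.delta)
  finally show ?case using add by simp
qed simp

lemma integral_scale_measure:
  fixes h :: "'b \<Rightarrow> real"
  assumes c: "0 \<le> c" and h: "h \<in> borel_measurable M"
  shows "integral\<^sup>L (scale_measure (ennreal c) M) h = c * integral\<^sup>L M h"
proof -
  have "scale_measure (ennreal c) M = density M (\<lambda>_. ennreal c)"
    by (rule measure_eqI) (auto simp: emeasure_density_const)
  then show ?thesis using c h by (simp add: integral_density)
qed

lemma compactly_supported_continuous_bounded:
  assumes "compactly_supported_continuous X h"
  shows "\<exists>B. \<forall>x\<in>topspace X. \<bar>h x\<bar> \<le> B"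
proof -
  let ?K = "X closure_of {p \<in> topspace X. h p \<noteq> 0}"
  have h: "continuous_map X euclideanreal h" "compactin X ?K"
    using assms by (auto simp: compactly_supported_continuous_def)
  have "compact (h ` ?K)" using image_compactin[OF h(2,1)] by simp
  then obtain B where B: "\<And>y. y \<in> h ` ?K \<Longrightarrow> \<bar>y\<bar> \<le> B"
    using compact_imp_bounded bounded_iff by (metis real_norm_def)
  have "\<bar>h x\<bar> \<le> max B 0" if x: "x \<in> topspace X" for x
  proof (cases "h x = 0")
    case False
    then have "x \<in> ?K" using x closure_of_subset[of "{p \<in> topspace X. h p \<noteq> 0}" X] by blast
    then show ?thesis using B[of "h x"] by simp
  qed simp
  then show ?thesis by blast
qed

section \<open>The limit functional and its measure\<close>

context nonarch_dynamics
begin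

definition generic_point :: 'a where
  "generic_point = (SOME x. \<not> exceptional x)"

lemma generic_point: "\<not> exceptional generic_point"
  unfolding generic_point_def using exists_nonexceptional by (rule someI_ex)

definition limit_mean :: "(('a poly \<Rightarrow> real) \<Rightarrow> real) \<Rightarrow> real" where
  "limit_mean h = lim (\<lambda>n. preimage_mean n generic_point (\<lambda>y. h (closed_point N y)))"

lemma tendsto_limit_mean:
  assumes h: "continuous_map (berkovich_line N) euclideanreal h" and x: "\<not> exceptional x"
  shows "(\<lambda>n. preimage_mean n x (\<lambda>y. h (closed_point N y))) \<longlonglongrightarrow> limit_mean h"
proof -
  obtain L where L: "\<And>x. \<not> exceptional x \<Longrightarrow> (\<lambda>n. preimage_mean n x (\<lambda>y. h (closed_point N y))) \<longlonglongrightarrow> L"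
    using equidistributed_continuous[OF h] unfolding equidistributed_def by blast
  have "limit_mean h = L" unfolding limit_mean_def by (rule limI[OF L[OF generic_point]])
  then show ?thesis using L[OF x] by simp
qed

lemma limit_mean_eqI:
  assumes "continuous_map (berkovich_line N) euclideanreal h"
    and "(\<lambda>n. preimage_mean n generic_point (\<lambda>y. h (closed_point N y))) \<longlonglongrightarrow> L"
  shows "limit_mean h = L"
  using LIMSEQ_unique[OF tendsto_limit_mean[OF assms(1) generic_point] assms(2)] .

text \<open>The ball contains every iterated preimage of \<open>generic_point\<close>, so
  nonnegativity on it passes to all the means and to their limit.\<close>

sublocale equilibrium: probability_functional "berkovich_line N"
  "ultrametric_ball (max escape_radius (N generic_point))" limit_mean
proof
  let ?X = "berkovich_line N"
  show "completely_regular_space ?X" by (rule completely_regular_berkovich_line)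
  show "Hausdorff_space ?X" by (rule Hausdorff_berkovich_line)
  show "compactin ?X (ultrametric_ball (max escape_radius (N generic_point)))"
    using compact_ultrametric_ball ultrametric_imp_berkovich
    by (auto simp: berkovich_line_eq compactin_subtopology ultrametric_ball_def)
  show "limit_mean (\<lambda>S. g S + h S) = limit_mean g + limit_mean h"
    if g: "continuous_map ?X euclideanreal g" and h: "continuous_map ?X euclideanreal h" for g h
    unfolding preimage_mean_add
    by (rule limit_mean_eqI[OF continuous_map_add[OF g h]], unfold preimage_mean_add)
       (intro tendsto_add tendsto_limit_mean g h generic_point)
  show "limit_mean (\<lambda>S. c * h S) = c * limit_mean h" if h: "continuous_map ?X euclideanreal h" for c h
    by (rule limit_mean_eqI[OF continuous_map_real_mult_left[OF h]], unfold preimage_mean_scale)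
       (intro tendsto_mult tendsto_const tendsto_limit_mean h generic_point)
  show "limit_mean (\<lambda>_. 1) = 1"
    by (rule limit_mean_eqI) (simp_all add: preimage_mean_const)
  show "0 \<le> limit_mean h"
    if h: "continuous_map ?X euclideanreal h"
      and nn: "\<And>S. S \<in> ultrametric_ball (max escape_radius (N generic_point)) \<Longrightarrow> 0 \<le> h S" for h
  proof (rule tendsto_lowerbound[OF tendsto_limit_mean[OF h generic_point]])
    have "preimage_mean n generic_point (\<lambda>_. 0) \<le> preimage_mean n generic_point (\<lambda>y. h (closed_point N y))" for n
      by (rule preimage_mean_mono) (intro nn closed_point_in_ultrametric_ball norm_preimage_le)
    then show "\<forall>\<^sub>F n in sequentially. 0 \<le> preimage_mean n generic_point (\<lambda>y. h (closed_point N y))"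
      by (simp add: preimage_mean_const)
  qed simp
qed

lemma integral_normalized_pullback:
  assumes h: "continuous_map (berkovich_line N) euclideanreal h"
  shows "integral\<^sup>L (normalized_pullback N f x n) h = preimage_mean n x (\<lambda>y. h (closed_point N y))"
proof -
  let ?B = "borel_of_topology (berkovich_line N)"
  let ?A = "{y. poly (F n) y = x}"
  let ?w = "\<lambda>y. real (order y (F n - [:x:]))"
  have A: "set_mset (proots (F n - [:x:])) = ?A"
    using set_count_proots[OF F_diff_const(3)] by simp
  have fin: "finite ?A" unfolding A[symmetric] by simp
  have hm: "h \<in> borel_measurable ?B" using h by (rule continuous_map_imp_borel_measurable) simp
  have meas: "closed_point N \<in> measurable (point_measure ?A (\<lambda>y. ennreal (?w y))) ?B"
    using closed_point_in_berkovich_line[OF nonarch]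
    by (simp add: measurable_point_measure_eq1 space_borel_of_topology)
  have pb: "pullback_point_mass N (F n) x = distr (point_measure ?A (\<lambda>y. ennreal (?w y))) ?B (closed_point N)"
    by (simp add: pullback_point_mass_def ennreal_of_nat_eq_real_of_nat)
  have "integral\<^sup>L (normalized_pullback N f x n) h = (1 / real d ^ n) * integral\<^sup>L (pullback_point_mass N (F n) x) h"
    unfolding normalized_pullback_def using hm by (intro integral_scale_measure) (auto simp: pb)
  also have "integral\<^sup>L (pullback_point_mass N (F n) x) h =
      integral\<^sup>L (point_measure ?A (\<lambda>y. ennreal (?w y))) (\<lambda>y. h (closed_point N y))"
    unfolding pb by (rule integral_distr[OF meas hm])
  also have "\<dots> = (\<Sum>y\<in>?A. ?w y * h (closed_point N y))"
    by (subst lebesgue_integral_point_measure_finite[OF fin]) auto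
  also have "\<dots> = (\<Sum>y\<in>#proots (F n - [:x:]). h (closed_point N y))"
    by (subst sum_mset_eq_sum_count[OF fin]) (simp_all only: A count_proots[OF F_diff_const(3)] subset_refl)
  finally show ?thesis by (simp add: preimage_mean_def)
qed

lemma weakly_converges_nonexceptional:
  assumes "\<not> exceptional x"
  shows "weakly_converges (berkovich_line N) (normalized_pullback N f x) equilibrium.riesz_measure"
  unfolding weakly_converges_def
proof (intro allI impI)
  fix h assume h: "compactly_supported_continuous (berkovich_line N) h"
  then have hc: "continuous_map (berkovich_line N) euclideanreal h"
    by (simp add: compactly_supported_continuous_def)
  obtain B where "\<And>S. S \<in> topspace (berkovich_line N) \<Longrightarrow> \<bar>h S\<bar> \<le> B"
    using compactly_supported_continuous_bounded[OF h] by blast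
  from equilibrium.integral_riesz_measure[OF hc this]
  show "(\<lambda>n. integral\<^sup>L (normalized_pullback N f x n) h) \<longlonglongrightarrow> integral\<^sup>L equilibrium.riesz_measure h"
    unfolding integral_normalized_pullback[OF hc] using tendsto_limit_mean[OF hc assms] by simp
qed

section \<open>Exceptional points\<close>

lemma exceptional_iterate_preimage:
  assumes x: "exceptional x"
  shows "(poly f ^^ n) y = x \<longleftrightarrow> y = x"
proof -
  have "poly f y = x \<longleftrightarrow> y = x" for y
  proof -
    have "poly f y - x = poly (smult (lead_coeff f) ([:- x, 1:] ^ d)) y"
      unfolding x[unfolded exceptional_def, symmetric] by simp
    then show ?thesis using lead_coeff_nz d_pos by (auto simp: power_0_left)
  qed
  then show ?thesis by (induction n arbitrary: y) auto
qed

lemma exceptional_normalized_pullback: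
  assumes x: "exceptional x"
  shows "normalized_pullback N f x n = point_mass N x"
proof (rule measure_eqI)
  show sets: "sets (normalized_pullback N f x n) = sets (point_mass N x)"
    by (simp add: normalized_pullback_def pullback_point_mass_def point_mass_def)
  fix A assume "A \<in> sets (normalized_pullback N f x n)"
  then have A: "A \<in> sets (borel_of_topology (berkovich_line N))"
    by (simp add: normalized_pullback_def pullback_point_mass_def)
  have pre: "{y. poly (F n) y = x} = {x}"
    using exceptional_iterate_preimage[OF x] by (auto simp: poly_poly_iterate)
  have "set_mset (proots (F n - [:x:])) \<subseteq> {x}"
    using iterate_preimage_iff exceptional_iterate_preimage[OF x] by blast
  \<comment> \<open>The fibre is a single point, so its multiplicity is the total number of
    preimages.\<close>
  then have "real (size (proots (F n - [:x:]))) = real (count (proots (F n - [:x:])) x)"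
    using sum_mset_eq_sum_count[of "{x}" "proots (F n - [:x:])" "\<lambda>_. 1"] by simp
  then have ord: "order x (F n - [:x:]) = d ^ n"
    unfolding size_iterate_preimages using count_proots[OF F_diff_const(3)] by simp
  have "emeasure (normalized_pullback N f x n) A =
      ennreal (1 / real d ^ n) * (of_nat (d ^ n) * emeasure (point_mass N x) A)"
    unfolding normalized_pullback_def
    by (simp add: emeasure_pullback_point_mass[OF nonarch degree_iterate_pos A] pre ord)
  also have "\<dots> = (ennreal (1 / real d ^ n) * of_nat (d ^ n)) * emeasure (point_mass N x) A"
    by (simp only: mult.assoc)
  also have "ennreal (1 / real d ^ n) * of_nat (d ^ n) = ennreal (1 / real d ^ n * real d ^ n)"
    by (subst ennreal_mult) (simp_all add: ennreal_of_nat_eq_real_of_nat)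
  also have "\<dots> = 1" using d_pos by simp
  finally show "emeasure (normalized_pullback N f x n) A = emeasure (point_mass N x) A" by simp
qed

text \<open>Near a totally invariant point \<open>f\<close> is contracting, so the preimages of any other point stay
  away from it.\<close>

lemma exceptional_isolated:
  assumes x: "exceptional x" and w: "w \<noteq> x"
  shows "\<exists>r>0. \<forall>n y. (poly f ^^ n) y = w \<longrightarrow> r \<le> N (y - x)"
proof -
  let ?b = "N (lead_coeff f)"
  have b: "0 < ?b" using lead_coeff_nz by simp
  have f: "N (poly f y - x) = ?b * N (y - x) ^ d" for y
  proof -
    have "poly f y - x = poly (smult (lead_coeff f) ([:- x, 1:] ^ d)) y"
      unfolding x[unfolded exceptional_def, symmetric] by simp
    also have "\<dots> = lead_coeff f * (y - x) ^ d" by simp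
    finally show ?thesis by (simp add: norm_mult norm_power)
  qed
  define r where "r = min (N (w - x)) (min 1 (1 / ?b))"
  have r: "0 < r" using w b by (simp add: r_def)
  have step: "N (poly f y - x) < r" if y: "N (y - x) < r" for y
  proof -
    have le: "N (y - x) \<le> 1" "?b * N (y - x) \<le> 1" using y b by (auto simp: r_def field_simps)
    have "N (y - x) ^ (d - 1) \<le> N (y - x) ^ 1"
      using degree_gt_1 le(1) by (intro power_decreasing) auto
    then have "?b * N (y - x) ^ (d - 1) \<le> ?b * N (y - x)" using b by simp
    then have "?b * N (y - x) ^ (d - 1) \<le> 1" using le(2) by linarith
    then have "?b * N (y - x) ^ (d - 1) * N (y - x) \<le> 1 * N (y - x)" by (intro mult_right_mono) auto
    moreover have "N (y - x) ^ d = N (y - x) ^ (d - 1) * N (y - x)"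
      using d_pos by (cases d) auto
    ultimately have "N (poly f y - x) \<le> N (y - x)" unfolding f by (simp add: mult.assoc)
    then show ?thesis using y by simp
  qed
  have "N ((poly f ^^ n) y - x) < r" if "N (y - x) < r" for n y
    by (induction n) (auto simp: that step)
  moreover have "\<not> N (w - x) < r" by (simp add: r_def)
  ultimately show ?thesis using r by (metis not_less)
qed

text \<open>A bump at \<open>x\<close> tells the measures apart. All pullbacks of \<open>x\<close>
  sit at \<open>x\<close> and give it integral 1, while the preimages of
  \<open>generic_point\<close> stay where the bump is 0.\<close>

lemma exceptional_not_weakly_converges:
  assumes x: "exceptional x"
  shows "\<not> weakly_converges (berkovich_line N) (normalized_pullback N f x) equilibrium.riesz_measure"
proof
  let ?X = "berkovich_line N"
  assume conv: "weakly_converges ?X (normalized_pullback N f x) equilibrium.riesz_measure"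
  obtain r where r: "0 < r" "\<And>n y. (poly f ^^ n) y = generic_point \<Longrightarrow> r \<le> N (y - x)"
    using exceptional_isolated[OF x, of generic_point] generic_point x by blast
  define h where "h S = max 0 (1 - (1 / r) * S [:- x, 1:])" for S :: "'a poly \<Rightarrow> real"
  have ev: "continuous_map ?X euclideanreal (\<lambda>S. S p)" for p
    unfolding berkovich_line_eq
    by (auto intro: continuous_on_subset[OF continuous_on_product_coordinates])
  have hc: "continuous_map ?X euclideanreal h"
    unfolding h_def
    by (intro continuous_map_real_max continuous_map_diff continuous_map_real_mult_left ev) auto
  have h_bounds: "\<bar>h S\<bar> \<le> 1" if "S \<in> topspace ?X" for S
    using that r(1) by (auto simp: h_def topspace_berkovich_line berkovich_seminorm_def)
  have "compactly_supported_continuous ?X h"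
    unfolding compactly_supported_continuous_def
  proof (intro conjI hc)
    \<comment> \<open>By the triangle inequality this closed set lies in a compact ball around the
      origin.\<close>
    let ?K = "{S \<in> topspace ?X. S [:- x, 1:] \<in> {..r}}"
    have cl: "closedin ?X ?K" by (rule closedin_continuous_map_preimage[OF ev]) simp
    have "compactin ?X {S. berkovich_seminorm N S \<and> S [:0, 1:] \<le> r + N x}"
      using compact_berkovich_ball[of N "r + N x"] by (auto simp: berkovich_line_eq compactin_subtopology)
    moreover have "?K \<subseteq> {S. berkovich_seminorm N S \<and> S [:0, 1:] \<le> r + N x}"
    proof
      fix S assume S: "S \<in> ?K"
      then have "berkovich_seminorm N S" by (simp add: topspace_berkovich_line)
      then have "S ([:- x, 1:] + [:x:]) \<le> S [:- x, 1:] + S [:x:]" "S [:x:] = N x"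
        unfolding berkovich_seminorm_def by blast+
      then show "S \<in> {S. berkovich_seminorm N S \<and> S [:0, 1:] \<le> r + N x}"
        using S by (simp add: topspace_berkovich_line)
    qed
    ultimately have K: "compactin ?X ?K" using cl by (rule closed_compactin)
    have "h S = 0" if "r < S [:- x, 1:]" for S
    proof -
      have "1 \<le> (1 / r) * S [:- x, 1:]" using that r(1) by (simp add: field_simps)
      then show ?thesis by (simp add: h_def)
    qed
    then have "{S \<in> topspace ?X. h S \<noteq> 0} \<subseteq> ?K" using not_le by fastforce
    then have "?X closure_of {S \<in> topspace ?X. h S \<noteq> 0} \<subseteq> ?K"
      using cl by (rule closure_of_minimal)
    then show "compactin ?X (?X closure_of {S \<in> topspace ?X. h S \<noteq> 0})"
      using K by (intro closed_compactin[OF K]) auto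
  qed
  with conv have "(\<lambda>n. integral\<^sup>L (normalized_pullback N f x n) h) \<longlonglongrightarrow> integral\<^sup>L equilibrium.riesz_measure h"
    by (simp add: weakly_converges_def)
  moreover have "integral\<^sup>L (normalized_pullback N f x n) h = 1" for n
  proof -
    have "preimage_mean n x (\<lambda>y. h (closed_point N y)) = preimage_mean n x (\<lambda>_. 1)"
      by (intro antisym preimage_mean_mono)
         (auto simp: exceptional_iterate_preimage[OF x] h_def closed_point_def)
    then show ?thesis by (simp add: integral_normalized_pullback[OF hc] preimage_mean_const)
  qed
  moreover have "integral\<^sup>L equilibrium.riesz_measure h = 0"
  proof -
    have "preimage_mean n generic_point (\<lambda>y. h (closed_point N y)) = preimage_mean n generic_point (\<lambda>_. 0)" for n
      using r by (intro antisym preimage_mean_mono) (auto simp: h_def closed_point_def field_simps)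
    then have "limit_mean h = 0" by (intro limit_mean_eqI[OF hc]) (simp add: preimage_mean_const)
    then show ?thesis using equilibrium.integral_riesz_measure[OF hc h_bounds] by simp
  qed
  ultimately show False using LIMSEQ_unique[OF tendsto_const] by fastforce
qed

lemma exceptional_iff_power_map:
  "exceptional x \<longleftrightarrow> (\<exists>z. global_coordinate z \<and> poly z x = 0 \<and> is_power_map_in z f)"
proof
  assume x: "exceptional x"
  \<comment> \<open>For \<open>z = a (t - x)\<close>, with \<open>t\<close> the standard coordinate,
    \<open>z \<circ>\<^sub>p f\<close> is \<open>a * lead_coeff f * (t - x)^d\<close>. This equals
    \<open>z^d\<close> exactly if \<open>a^(d - 1)\<close> is the leading coefficient.\<close>
  obtain a where a: "a ^ (d - 1) = lead_coeff f"
    using nth_root_exists[of "d - 1" "lead_coeff f"] degree_gt_1 by auto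
  have a0: "a \<noteq> 0" using a lead_coeff_nz degree_gt_1 by (auto simp: power_0_left)
  define z where "z = smult a [:- x, 1:]"
  have "p = (p \<circ>\<^sub>p [:x, 1 / a:]) \<circ>\<^sub>p z" for p
  proof -
    have "[:x, 1 / a:] \<circ>\<^sub>p z = [:0, 1:]" using a0 by (simp add: z_def pcompose_pCons)
    then show ?thesis by (simp add: pcompose_assoc[symmetric] pcompose_idR)
  qed
  then have "global_coordinate z" unfolding global_coordinate_def by blast
  moreover have "poly z x = 0" by (simp add: z_def)
  moreover have "is_power_map_in z f"
  proof -
    have "z \<circ>\<^sub>p f = smult a (f - [:x:])" by (simp add: z_def pcompose_pCons pcompose_smult smult_diff_right)
    also have "f - [:x:] = smult (a ^ (d - 1)) ([:- x, 1:] ^ d)"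
      using x unfolding exceptional_def a .
    also have "smult a \<dots> = smult (a ^ d) ([:- x, 1:] ^ d)" using d_pos by (cases d) auto
    also have "\<dots> = z ^ d" by (simp only: z_def smult_power)
    finally show ?thesis by (simp add: is_power_map_in_def)
  qed
  ultimately show "\<exists>z. global_coordinate z \<and> poly z x = 0 \<and> is_power_map_in z f" by blast
next
  assume "\<exists>z. global_coordinate z \<and> poly z x = 0 \<and> is_power_map_in z f"
  then obtain z where z: "global_coordinate z" "poly z x = 0" "z \<circ>\<^sub>p f = z ^ d"
    by (auto simp: is_power_map_in_def)
  \<comment> \<open>Expressing the standard coordinate through \<open>z\<close> forces
    \<open>z\<close> to have degree 1.\<close>
  obtain q where "[:0, 1:] = q \<circ>\<^sub>p z" using z(1) unfolding global_coordinate_def by blast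
  then have "degree q * degree z = 1" by (metis degree_pcompose degree_pCons_eq_if one_neq_zero degree_0 One_nat_def pCons_eq_0_iff)
  then have dz: "degree z = 1" by simp
  obtain b p where p: "z = pCons b p" by (rule pCons_cases)
  then have "degree p = 0" "p \<noteq> 0" using dz by (auto split: if_splits)
  then obtain a where ab: "z = [:b, a:]" "a \<noteq> 0" using p by (auto elim: degree_eq_zeroE)
  have "b = - a * x" using z(2) unfolding ab by (simp add: eq_neg_iff_add_eq_0 mult.commute)
  then have z': "z = smult a [:- x, 1:]" by (simp add: ab)
  have "smult a (f - [:x:]) = z \<circ>\<^sub>p f" by (simp add: z' pcompose_pCons pcompose_smult smult_diff_right)
  also have "\<dots> = z ^ d" by (rule z(3))
  also have "\<dots> = smult (a ^ d) ([:- x, 1:] ^ d)" by (simp only: z' smult_power)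
  also have "\<dots> = smult a (smult (a ^ (d - 1)) ([:- x, 1:] ^ d))" using d_pos by (cases d) auto
  finally have fx: "f - [:x:] = smult (a ^ (d - 1)) ([:- x, 1:] ^ d)"
    using ab(2) by (metis smult_cancel)
  then have "order x (f - [:x:]) = d" using ab(2) by (simp add: order_smult order_power_n_n)
  then show "exceptional x" by (simp add: exceptional_iff_order)
qed

end

theorem theoremA:
  fixes N :: "'a::{alg_closed_field, field_char_0} \<Rightarrow> real" and f :: "'a poly"
  assumes "complete_nonarch_norm N" and "degree f > 1"
  shows "\<exists>\<rho>. radon_measure (berkovich_line N) \<rho> \<and> prob_space \<rho> \<and>
    (\<exists>\<^sub>\<le>\<^sub>1 x. \<not> weakly_converges (berkovich_line N) (normalized_pullback N f x) \<rho>) \<and>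
    (\<forall>x. \<not> weakly_converges (berkovich_line N) (normalized_pullback N f x) \<rho> \<longleftrightarrow>
       (\<exists>z. global_coordinate z \<and> poly z x = 0 \<and> is_power_map_in z f)) \<and>
    (\<forall>x. \<not> weakly_converges (berkovich_line N) (normalized_pullback N f x) \<rho> \<longrightarrow>
       (\<forall>n. normalized_pullback N f x n = point_mass N x))"
proof -
  interpret nonarch_dynamics N f
    using assms by unfold_locales (auto simp: complete_nonarch_norm_def)
  have iff: "\<not> weakly_converges (berkovich_line N) (normalized_pullback N f x) equilibrium.riesz_measure
      \<longleftrightarrow> exceptional x" for x
    using weakly_converges_nonexceptional exceptional_not_weakly_converges by blast
  show ?thesis
  proof (intro exI[of _ equilibrium.riesz_measure] conjI)
    show "radon_measure (berkovich_line N) equilibrium.riesz_measure"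
      by (rule equilibrium.radon_measure_riesz_measure)
    show "prob_space equilibrium.riesz_measure" by (rule equilibrium.prob_space_riesz_measure)
  qed (unfold iff, auto simp: exceptional_iff_power_map[symmetric] exceptional_normalized_pullback
      intro!: Uniq_I exceptional_unique)
qed

end
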